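(* Let $Q$ be an arbitrary additive abelian group and let $\mathfrak{g}$ be a $Q$-graded simple Lie algebra (with minimal grading) over an algebraically closed field $\Bbbk$ such that $\dim\mathfrak{g}<|\Bbbk|$. Then there exist a subgroup $P\subset Q$ and a simple Lie algebra $\mathfrak{a}$ over $\Bbbk$ with a $Q/P$-grading such that $\mathfrak{g}\simeq\mathfrak{g}(Q,P,\mathfrak{a})$ as $Q$-graded Lie algebras.
   Context: All algebras are over $\Bbbk$; the inequality $\dim\mathfrak{g}<|\Bbbk|$ is between cardinals. A $Q$-graded Lie algebra is a Lie algebra $\mathfrak{g}=\bigoplus_{\alpha\in Q}\mathfrak{g}_\alpha$ with $[\mathfrak{g}_\alpha,\mathfrak{g}_\beta]\subset\mathfrak{g}_{\alpha+\beta}$. It is graded simple if it is not commutative and contains no non-trivial graded ideal (no graded ideal other than $0$ and $\mathfrak{g}$). The grading is minimal if $\{\alpha\in Q:\mathfrak{g}_\alpha\neq0\}$ generates $Q$. Loop algebra: for a subgroup $P\subset Q$ and a simple Lie algebra $\mathfrak{a}=\bigoplus_{\bar\alpha\in Q/P}\mathfrak{a}_{\bar\alpha}$ with a $Q/P$-grading, let $\Bbbk Q$ be the group algebra with basis $\{t^\alpha:\alpha\in Q\}$, $t^\alpha t^\beta=t^{\alpha+\beta}$, and give $\mathfrak{a}\otimes\Bbbk Q$ the bracket $[x\otimes t^\alpha,y\otimes t^\beta]=[x,y]\otimes t^{\alpha+\beta}$. Then $\mathfrak{g}(Q,P,\mathfrak{a}):=\bigoplus_{\alpha\in Q}\mathfrak{a}_{\bar\alpha}\otimes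 t^\alpha$, where $\bar\alpha=\alpha+P$, is a $Q$-graded Lie subalgebra with $\mathfrak{g}(Q,P,\mathfrak{a})_\alpha=\mathfrak{a}_{\bar\alpha}\otimes t^\alpha$. An isomorphism of $Q$-graded Lie algebras means a Lie algebra isomorphism carrying the degree $\alpha$ component onto the degree $\alpha$ component for all $\alpha\in Q$. *)

theory Defs
  imports
    "HOL-Library.Poly_Mapping"
    "HOL-Library.Set_Algebras"
    "HOL-Library.Equipollence"
    "HOL-Computational_Algebra.Group_Closure"
    "HOL-Computational_Algebra.Polynomial"
begin

section \<open>Lie algebras on subspaces of a vector space\<close>

text \<open>
  The underlying space \<open>L\<close> is a subspace of an ambient vector space and the
  bracket only matters on \<open>L\<close>. No restriction on the characteristic is made.
\<close>

locale lie_algebra = vector_space scale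
  for scale :: "'k::field \<Rightarrow> 'v::ab_group_add \<Rightarrow> 'v" (infixr \<open>*s\<close> 75) +
  fixes L :: "'v set"
    and br :: "'v \<Rightarrow> 'v \<Rightarrow> 'v"
  assumes subspace_carrier: "subspace L"
    and br_closed: "x \<in> L \<Longrightarrow> y \<in> L \<Longrightarrow> br x y \<in> L"
    and br_add_left: "x \<in> L \<Longrightarrow> y \<in> L \<Longrightarrow> z \<in> L \<Longrightarrow> br (x + y) z = br x z + br y z"
    and br_add_right: "x \<in> L \<Longrightarrow> y \<in> L \<Longrightarrow> z \<in> L \<Longrightarrow> br x (y + z) = br x y + br x z"
    and br_scale_left: "x \<in> L \<Longrightarrow> y \<in> L \<Longrightarrow> br (c *s x) y = c *s br x y"
    and br_scale_right: "x \<in> L \<Longrightarrow> y \<in> L \<Longrightarrow> br x (c *s y) = c *s br x y"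
    and br_self: "x \<in> L \<Longrightarrow> br x x = 0"
    and jacobi: "x \<in> L \<Longrightarrow> y \<in> L \<Longrightarrow> z \<in> L \<Longrightarrow>
      br x (br y z) + br y (br z x) + br z (br x y) = 0"
begin

definition commutative :: bool where
  "commutative \<longleftrightarrow> (\<forall>x\<in>L. \<forall>y\<in>L. br x y = 0)"

definition lie_ideal :: "'v set \<Rightarrow> bool" where
  "lie_ideal J \<longleftrightarrow> subspace J \<and> J \<subseteq> L \<and> (\<forall>x\<in>L. \<forall>y\<in>J. br x y \<in> J)"

end

locale simple_lie_algebra = lie_algebra +
  assumes not_commutative: "\<not> commutative"
    and simple: "lie_ideal J \<Longrightarrow> J = {0} \<or> J = L"


section \<open>Gradings\<close>

text \<open>\<open>V\<close> is the internal direct sum of the subspaces \<open>D i\<close> with \<open>i \<in> I\<close>.\<close>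

definition is_direct_sum :: "'i set \<Rightarrow> ('i \<Rightarrow> 'v::comm_monoid_add set) \<Rightarrow> 'v set \<Rightarrow> bool" where
  "is_direct_sum I D V \<longleftrightarrow>
     (\<forall>i\<in>I. D i \<subseteq> V) \<and>
     (\<forall>x\<in>V. \<exists>!f. finite {i. f i \<noteq> 0} \<and> (\<forall>i\<in>I. f i \<in> D i) \<and> (\<forall>i. i \<notin> I \<longrightarrow> f i = 0) \<and>
        x = (\<Sum>i | f i \<noteq> 0. f i))"

text \<open>
  The index set is used with \<open>I = UNIV\<close> for an abelian group given as a type, and
  with \<open>I = quotient_group P\<close> below for the quotient by a subgroup \<open>P\<close>.
\<close>

locale graded_lie_algebra = lie_algebra scale L br
  for scale :: "'k::field \<Rightarrow> 'v::ab_group_add \<Rightarrow> 'v" (infixr \<open>*s\<close> 75)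
    and L :: "'v set" and br :: "'v \<Rightarrow> 'v \<Rightarrow> 'v" +
  fixes I :: "'i::plus set"
    and D :: "'i \<Rightarrow> 'v set"
  assumes subspace_component: "i \<in> I \<Longrightarrow> subspace (D i)"
    and direct_sum: "is_direct_sum I D L"
    and br_component: "i \<in> I \<Longrightarrow> j \<in> I \<Longrightarrow> x \<in> D i \<Longrightarrow> y \<in> D j \<Longrightarrow> br x y \<in> D (i + j)"
begin

definition graded_ideal :: "'v set \<Rightarrow> bool" where
  "graded_ideal J \<longleftrightarrow> lie_ideal J \<and> is_direct_sum I (\<lambda>i. J \<inter> D i) J"

end

locale graded_simple_lie_algebra = graded_lie_algebra +
  assumes not_commutative: "\<not> commutative"
    and graded_simple: "graded_ideal J \<Longrightarrow> J = {0} \<or> J = L"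

definition minimal_grading :: "('q::ab_group_add \<Rightarrow> 'v::zero set) \<Rightarrow> bool" where
  "minimal_grading D \<longleftrightarrow> group_closure {\<alpha>. D \<alpha> \<noteq> {0}} = UNIV"

definition graded_lie_iso ::
    "('k \<Rightarrow> 'v::ab_group_add \<Rightarrow> 'v) \<Rightarrow> 'v set \<Rightarrow> ('v \<Rightarrow> 'v \<Rightarrow> 'v) \<Rightarrow> ('q \<Rightarrow> 'v set) \<Rightarrow>
     ('k \<Rightarrow> 'w::ab_group_add \<Rightarrow> 'w) \<Rightarrow> 'w set \<Rightarrow> ('w \<Rightarrow> 'w \<Rightarrow> 'w) \<Rightarrow> ('q \<Rightarrow> 'w set) \<Rightarrow>
     ('v \<Rightarrow> 'w) \<Rightarrow> bool" where
  "graded_lie_iso s L br D s' L' br' D' \<phi> \<longleftrightarrow>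
     bij_betw \<phi> L L' \<and>
     (\<forall>x\<in>L. \<forall>y\<in>L. \<phi> (x + y) = \<phi> x + \<phi> y) \<and>
     (\<forall>c. \<forall>x\<in>L. \<phi> (s c x) = s' c (\<phi> x)) \<and>
     (\<forall>x\<in>L. \<forall>y\<in>L. \<phi> (br x y) = br' (\<phi> x) (\<phi> y)) \<and>
     (\<forall>\<alpha>. \<phi> ` D \<alpha> = D' \<alpha>)"


section \<open>Quotients of an abelian group\<close>

definition is_subgroup :: "'q::ab_group_add set \<Rightarrow> bool" where
  "is_subgroup P \<longleftrightarrow> 0 \<in> P \<and> (\<forall>\<alpha>\<in>P. \<forall>\<beta>\<in>P. \<alpha> + \<beta> \<in> P) \<and> (\<forall>\<alpha>\<in>P. - \<alpha> \<in> P)"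

text \<open>
  The group law of the quotient is the elementwise sum of sets; see \<open>coset_add\<close>.
\<close>

definition quotient_group :: "'q::ab_group_add set \<Rightarrow> 'q set set" where
  "quotient_group P = range (\<lambda>\<alpha>. \<alpha> +o P)"

lemma coset_add:
  assumes "is_subgroup P"
  shows "(\<alpha> +o P) + (\<beta> +o P) = (\<alpha> + \<beta>) +o P"
proof -
  have "P + P = P"
    using assms unfolding is_subgroup_def
    by (auto simp: set_plus_def) (metis add.right_neutral)
  then show ?thesis
    by (simp add: set_plus_rearrange)
qed


section \<open>Loop algebras\<close>

text \<open>
  The group algebra of \<open>'q\<close> over \<open>'k\<close> is \<open>'q \<Rightarrow>\<^sub>0 'k\<close> with the library's convolution
  product, \<open>t\<^sup>\<alpha>\<close> being \<open>Poly_Mapping.single \<alpha> 1\<close>. Since the \<open>t\<^sup>\<alpha>\<close> form a basis, the tensor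
  product of \<open>\<aa>\<close> (carried by \<open>A \<subseteq> 'v\<close>) with it is realised by the finitely supported functions
  \<open>'q \<Rightarrow>\<^sub>0 'v\<close> with values in \<open>A\<close>, where \<open>x \<otimes> t\<^sup>\<alpha>\<close> is \<open>Poly_Mapping.single \<alpha> x\<close>. The
  universal property is proved in \<open>tensor_exists\<close> and \<open>tensor_unique\<close>.
\<close>

definition pm_scale :: "('k \<Rightarrow> 'v \<Rightarrow> 'v) \<Rightarrow> 'k \<Rightarrow> ('q \<Rightarrow>\<^sub>0 'v::zero) \<Rightarrow> ('q \<Rightarrow>\<^sub>0 'v)" where
  "pm_scale s c f = Poly_Mapping.map (s c) f"

definition tensor_carrier :: "'v set \<Rightarrow> ('q \<Rightarrow>\<^sub>0 'v::zero) set" where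
  "tensor_carrier A = {f. \<forall>\<alpha>. Poly_Mapping.lookup f \<alpha> \<in> A}"

definition tensor :: "('k::zero \<Rightarrow> 'v \<Rightarrow> 'v) \<Rightarrow> 'v \<Rightarrow> ('q \<Rightarrow>\<^sub>0 'k) \<Rightarrow> ('q \<Rightarrow>\<^sub>0 'v::zero)" where
  "tensor s x p = Poly_Mapping.map (\<lambda>c. s c x) p"

text \<open>The bilinear extension of \<open>[x \<otimes> t\<^sup>\<alpha>, y \<otimes> t\<^sup>\<beta>] = [x, y] \<otimes> t\<^sup>\<alpha>\<^sup>+\<^sup>\<beta>\<close>.\<close>

definition tensor_br ::
    "('v \<Rightarrow> 'v \<Rightarrow> 'v) \<Rightarrow> ('q::plus \<Rightarrow>\<^sub>0 'v::comm_monoid_add) \<Rightarrow> ('q \<Rightarrow>\<^sub>0 'v) \<Rightarrow> ('q \<Rightarrow>\<^sub>0 'v)" where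
  "tensor_br br f g =
     (\<Sum>\<alpha>\<in>Poly_Mapping.keys f. \<Sum>\<beta>\<in>Poly_Mapping.keys g.
        Poly_Mapping.single (\<alpha> + \<beta>) (br (Poly_Mapping.lookup f \<alpha>) (Poly_Mapping.lookup g \<beta>)))"

text \<open>
  \<open>E\<close> is the grading of \<open>\<aa>\<close> by the quotient by \<open>P\<close>; the loop algebra is the direct sum of its
  components by \<open>loop_graded\<close>.
\<close>

definition loop_component ::
    "'q::ab_group_add set \<Rightarrow> ('q set \<Rightarrow> 'v set) \<Rightarrow> 'q \<Rightarrow> ('q \<Rightarrow>\<^sub>0 'v::zero) set" where
  "loop_component P E \<alpha> = Poly_Mapping.single \<alpha> ` E (\<alpha> +o P)"

definition loop_carrier ::
    "'q::ab_group_add set \<Rightarrow> ('q set \<Rightarrow> 'v set) \<Rightarrow> ('q \<Rightarrow>\<^sub>0 'v::zero) set" where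
  "loop_carrier P E = {f. \<forall>\<alpha>. Poly_Mapping.lookup f \<alpha> \<in> E (\<alpha> +o P)}"


subsection \<open>The tensor product\<close>

context vector_space
begin

lemma lookup_pm_scale [simp]:
  "Poly_Mapping.lookup (pm_scale scale c f) \<alpha> = scale c (Poly_Mapping.lookup f \<alpha>)"
  by (simp add: pm_scale_def map.rep_eq when_def)

lemma lookup_tensor [simp]:
  "Poly_Mapping.lookup (tensor scale x p) \<alpha> = scale (Poly_Mapping.lookup p \<alpha>) x"
  by (simp add: tensor_def map.rep_eq when_def)

lemma vector_space_pm_scale: "vector_space (pm_scale scale)"
  by unfold_locales
    (auto intro!: poly_mapping_eqI simp: lookup_add scale_right_distrib scale_left_distrib)

lemma pm_scale_single [simp]:
  "pm_scale scale c (Poly_Mapping.single \<alpha> x) = Poly_Mapping.single \<alpha> (scale c x)"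
  by (auto intro!: poly_mapping_eqI simp: lookup_single when_def)

lemma tensor_single [simp]:
  "tensor scale x (Poly_Mapping.single \<alpha> c) = Poly_Mapping.single \<alpha> (scale c x)"
  by (auto intro!: poly_mapping_eqI simp: lookup_single when_def)

end

lemma pm_sum_singles:
  fixes f :: "'q \<Rightarrow>\<^sub>0 'v::comm_monoid_add"
  assumes "finite S" "Poly_Mapping.keys f \<subseteq> S"
  shows "f = (\<Sum>\<alpha>\<in>S. Poly_Mapping.single \<alpha> (Poly_Mapping.lookup f \<alpha>))"
proof (rule poly_mapping_eqI)
  fix \<beta>
  have "(\<Sum>\<alpha>\<in>S. Poly_Mapping.lookup f \<alpha> when \<alpha> = \<beta>) =
      (if \<beta> \<in> S then Poly_Mapping.lookup f \<beta> else 0)"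
    unfolding when_def by (simp add: sum.delta' assms(1))
  also have "\<dots> = Poly_Mapping.lookup f \<beta>"
    using assms(2) by (auto simp: in_keys_iff)
  finally show "Poly_Mapping.lookup f \<beta> =
      Poly_Mapping.lookup (\<Sum>\<alpha>\<in>S. Poly_Mapping.single \<alpha> (Poly_Mapping.lookup f \<alpha>)) \<beta>"
    by (simp add: lookup_sum lookup_single)
qed

context vector_space_pair
begin

lemma tensor_unique:
  fixes h h' :: "('q \<Rightarrow>\<^sub>0 'b) \<Rightarrow> 'c"
  assumes A: "vs1.subspace A"
    and add: "\<And>f g. f \<in> tensor_carrier A \<Longrightarrow> g \<in> tensor_carrier A \<Longrightarrow> h (f + g) = h f + h g"
    and add': "\<And>f g. f \<in> tensor_carrier A \<Longrightarrow> g \<in> tensor_carrier A \<Longrightarrow> h' (f + g) = h' f + h' g"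
    and eq: "\<And>x p. x \<in> A \<Longrightarrow> h (tensor s1 x p) = h' (tensor s1 x p)"
    and f: "f \<in> tensor_carrier A"
  shows "h f = h' f"
proof -
  have zero: "0 \<in> tensor_carrier A"
    using A by (simp add: tensor_carrier_def vs1.subspace_0)
  have single: "Poly_Mapping.single \<alpha> x \<in> tensor_carrier A" if "x \<in> A" for \<alpha> x
    using A that by (simp add: tensor_carrier_def lookup_single when_def vs1.subspace_0)
  have plus: "f + g \<in> tensor_carrier A" if "f \<in> tensor_carrier A" "g \<in> tensor_carrier A" for f g
    using A that by (simp add: tensor_carrier_def lookup_add vs1.subspace_add)
  have val: "Poly_Mapping.lookup f \<alpha> \<in> A" for \<alpha>
    using f by (simp add: tensor_carrier_def)
  have h0: "h 0 = 0" "h' 0 = 0"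
    using add[OF zero zero] add'[OF zero zero] by simp_all
  have sgl: "h (Poly_Mapping.single \<alpha> x) = h' (Poly_Mapping.single \<alpha> x)" if "x \<in> A" for \<alpha> x
    using eq[OF that, of "Poly_Mapping.single \<alpha> 1"] by simp
  have "(\<Sum>\<alpha>\<in>S. Poly_Mapping.single \<alpha> (Poly_Mapping.lookup f \<alpha>)) \<in> tensor_carrier A \<and>
      h (\<Sum>\<alpha>\<in>S. Poly_Mapping.single \<alpha> (Poly_Mapping.lookup f \<alpha>)) =
      h' (\<Sum>\<alpha>\<in>S. Poly_Mapping.single \<alpha> (Poly_Mapping.lookup f \<alpha>))" if "finite S" for S
    using that
    by (induction S) (simp_all add: zero h0 plus single val add add' sgl)
  from this[of "Poly_Mapping.keys f"] show ?thesis
    using pm_sum_singles[of "Poly_Mapping.keys f" f] by simp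
qed

lemma tensor_exists:
  fixes b :: "'b \<Rightarrow> ('q \<Rightarrow>\<^sub>0 'a) \<Rightarrow> 'c"
  assumes A: "vs1.subspace A"
    and add1: "\<And>x y p. x \<in> A \<Longrightarrow> y \<in> A \<Longrightarrow> b (x + y) p = b x p + b y p"
    and add2: "\<And>x p q. x \<in> A \<Longrightarrow> b x (p + q) = b x p + b x q"
    and scale1: "\<And>c x p. x \<in> A \<Longrightarrow> b (s1 c x) p = s2 c (b x p)"
    and scale2: "\<And>c x p. x \<in> A \<Longrightarrow> b x (pm_scale (*) c p) = s2 c (b x p)"
  obtains h where
    "\<And>f g. f \<in> tensor_carrier A \<Longrightarrow> g \<in> tensor_carrier A \<Longrightarrow> h (f + g) = h f + h g"
    "\<And>c f. f \<in> tensor_carrier A \<Longrightarrow> h (pm_scale s1 c f) = s2 c (h f)"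
    "\<And>x p. x \<in> A \<Longrightarrow> h (tensor s1 x p) = b x p"
proof -
  let ?l = Poly_Mapping.lookup and ?k = Poly_Mapping.keys
  define h where "h f = (\<Sum>\<alpha>\<in>?k f. b (?l f \<alpha>) (Poly_Mapping.single \<alpha> 1))" for f
  have zero: "0 \<in> A"
    using A by (rule vs1.subspace_0)
  have b0: "b 0 p = 0" for p
    using add1[OF zero zero, of p] by simp
  have b0': "b x 0 = 0" if "x \<in> A" for x
    using add2[OF that, of 0 0] by simp
  have h_sup: "h f = (\<Sum>\<alpha>\<in>S. b (?l f \<alpha>) (Poly_Mapping.single \<alpha> 1))"
    if "finite S" "?k f \<subseteq> S" for f S
    unfolding h_def using that by (intro sum.mono_neutral_left) (auto simp: in_keys_iff b0)
  have "h (f + g) = h f + h g" if "f \<in> tensor_carrier A" "g \<in> tensor_carrier A" for f g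
  proof -
    let ?S = "?k f \<union> ?k g"
    have "?k (f + g) \<subseteq> ?S"
      by (rule keys_add)
    then show ?thesis
      using that
      by (simp add: h_sup[of ?S] lookup_add add1 sum.distrib tensor_carrier_def)
  qed
  moreover have "h (pm_scale s1 c f) = s2 c (h f)" if "f \<in> tensor_carrier A" for c f
  proof -
    have "?k (pm_scale s1 c f) \<subseteq> ?k f"
      by (auto simp: in_keys_iff)
    then show ?thesis
      using that
      by (simp add: h_sup[of "?k f"] scale1 vs2.scale_sum_right tensor_carrier_def)
  qed
  moreover have "h (tensor s1 x p) = b x p" if "x \<in> A" for x p
  proof -
    have one: "b (s1 c x) (Poly_Mapping.single \<alpha> 1) = b x (Poly_Mapping.single \<alpha> c)" for c \<alpha>
    proof -
      have "pm_scale (*) c (Poly_Mapping.single \<alpha> 1) = Poly_Mapping.single \<alpha> c"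
        by (auto intro!: poly_mapping_eqI simp: pm_scale_def map.rep_eq lookup_single when_def)
      then show ?thesis
        using scale1[OF that, of c "Poly_Mapping.single \<alpha> 1"]
          scale2[OF that, of c "Poly_Mapping.single \<alpha> 1"] by simp
    qed
    have bsum: "b x (\<Sum>\<alpha>\<in>S. F \<alpha>) = (\<Sum>\<alpha>\<in>S. b x (F \<alpha>))"
      for S :: "'q set" and F :: "'q \<Rightarrow> 'q \<Rightarrow>\<^sub>0 'a"
      by (induction S rule: infinite_finite_induct) (simp_all add: b0' add2 that)
    have "?k (tensor s1 x p) \<subseteq> ?k p"
      by (auto simp: in_keys_iff)
    then have "h (tensor s1 x p) = (\<Sum>\<alpha>\<in>?k p. b x (Poly_Mapping.single \<alpha> (?l p \<alpha>)))"
      by (simp add: h_sup[of "?k p"] one)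
    also have "\<dots> = b x p"
      using pm_sum_singles[of "?k p" p] by (simp flip: bsum)
    finally show ?thesis .
  qed
  ultimately show ?thesis
    using that by blast
qed

end


subsection \<open>The bracket\<close>

context lie_algebra
begin

lemma zero_carrier: "0 \<in> L"
  by (rule subspace_0[OF subspace_carrier])

lemma br_zero_left [simp]: "x \<in> L \<Longrightarrow> br 0 x = 0"
  using br_add_left[OF zero_carrier zero_carrier, of x] by simp

lemma br_zero_right [simp]: "x \<in> L \<Longrightarrow> br x 0 = 0"
  using br_add_right[OF _ zero_carrier zero_carrier, of x] by simp

lemma br_anti: "x \<in> L \<Longrightarrow> y \<in> L \<Longrightarrow> br y x = - br x y"
  using br_self[of "x + y"] br_self[of x] br_self[of y] subspace_add[OF subspace_carrier, of x y]
  by (simp add: br_add_left br_add_right add_eq_0_iff)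

lemma tensor_carrier_zero: "0 \<in> tensor_carrier L"
  by (simp add: tensor_carrier_def zero_carrier)

lemma tensor_carrier_single: "x \<in> L \<Longrightarrow> Poly_Mapping.single \<alpha> x \<in> tensor_carrier L"
  by (simp add: tensor_carrier_def lookup_single when_def zero_carrier)

lemma tensor_carrier_add:
  "f \<in> tensor_carrier L \<Longrightarrow> g \<in> tensor_carrier L \<Longrightarrow> f + g \<in> tensor_carrier L"
  by (simp add: tensor_carrier_def lookup_add subspace_add[OF subspace_carrier])

lemma tensor_carrier_scale: "f \<in> tensor_carrier L \<Longrightarrow> pm_scale scale c f \<in> tensor_carrier L"
  by (simp add: tensor_carrier_def subspace_scale[OF subspace_carrier])

lemma tensor_carrier_sum:
  "(\<And>i. i \<in> S \<Longrightarrow> F i \<in> tensor_carrier L) \<Longrightarrow> sum F S \<in> tensor_carrier L"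
  by (induction S rule: infinite_finite_induct)
    (simp_all add: tensor_carrier_zero tensor_carrier_add)

lemma lookup_carrier: "f \<in> tensor_carrier L \<Longrightarrow> Poly_Mapping.lookup f \<alpha> \<in> L"
  by (simp add: tensor_carrier_def)

lemma tensor_br_superset:
  assumes f: "f \<in> tensor_carrier L" and g: "g \<in> tensor_carrier L"
    and S: "finite S" "Poly_Mapping.keys f \<subseteq> S"
    and T: "finite T" "Poly_Mapping.keys g \<subseteq> T"
  shows "tensor_br br f g =
    (\<Sum>\<alpha>\<in>S. \<Sum>\<beta>\<in>T. Poly_Mapping.single (\<alpha> + \<beta>)
      (br (Poly_Mapping.lookup f \<alpha>) (Poly_Mapping.lookup g \<beta>)))"
proof -
  have "(\<Sum>\<beta>\<in>Poly_Mapping.keys g. Poly_Mapping.single (\<alpha> + \<beta>)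
      (br (Poly_Mapping.lookup f \<alpha>) (Poly_Mapping.lookup g \<beta>))) =
    (\<Sum>\<beta>\<in>T. Poly_Mapping.single (\<alpha> + \<beta>)
      (br (Poly_Mapping.lookup f \<alpha>) (Poly_Mapping.lookup g \<beta>)))" for \<alpha>
    using T by (intro sum.mono_neutral_left)
      (auto simp: in_keys_iff lookup_carrier[OF f])
  then have "tensor_br br f g = (\<Sum>\<alpha>\<in>Poly_Mapping.keys f. \<Sum>\<beta>\<in>T. Poly_Mapping.single (\<alpha> + \<beta>)
      (br (Poly_Mapping.lookup f \<alpha>) (Poly_Mapping.lookup g \<beta>)))"
    by (simp add: tensor_br_def)
  also have "\<dots> = (\<Sum>\<alpha>\<in>S. \<Sum>\<beta>\<in>T. Poly_Mapping.single (\<alpha> + \<beta>)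
      (br (Poly_Mapping.lookup f \<alpha>) (Poly_Mapping.lookup g \<beta>)))"
    using S by (intro sum.mono_neutral_left)
      (auto simp: in_keys_iff lookup_carrier[OF g])
  finally show ?thesis .
qed

lemma tensor_br_single [simp]:
  assumes "x \<in> L" "y \<in> L"
  shows "tensor_br br (Poly_Mapping.single \<alpha> x) (Poly_Mapping.single \<beta> y) =
    Poly_Mapping.single (\<alpha> + \<beta>) (br x y)"
  using assms
  by (subst tensor_br_superset[of _ _ "{\<alpha>}" "{\<beta>}"]) (simp_all add: tensor_carrier_single)

lemma tensor_br_add_left:
  assumes "f \<in> tensor_carrier L" "g \<in> tensor_carrier L" "h \<in> tensor_carrier L"
  shows "tensor_br br (f + g) h = tensor_br br f h + tensor_br br g h"
proof -
  let ?S = "Poly_Mapping.keys f \<union> Poly_Mapping.keys g"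
  have "Poly_Mapping.keys (f + g) \<subseteq> ?S"
    by (rule keys_add)
  then show ?thesis
    using assms
    by (simp add: tensor_br_superset[of _ _ ?S "Poly_Mapping.keys h"] tensor_carrier_add
        lookup_add br_add_left lookup_carrier single_add sum.distrib)
qed

lemma tensor_br_add_right:
  assumes "f \<in> tensor_carrier L" "g \<in> tensor_carrier L" "h \<in> tensor_carrier L"
  shows "tensor_br br f (g + h) = tensor_br br f g + tensor_br br f h"
proof -
  let ?S = "Poly_Mapping.keys g \<union> Poly_Mapping.keys h"
  have "Poly_Mapping.keys (g + h) \<subseteq> ?S"
    by (rule keys_add)
  then show ?thesis
    using assms
    by (simp add: tensor_br_superset[of _ _ "Poly_Mapping.keys f" ?S] tensor_carrier_add
        lookup_add br_add_right lookup_carrier single_add sum.distrib)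
qed

lemma pm_scale_sum: "pm_scale scale c (sum F S) = (\<Sum>i\<in>S. pm_scale scale c (F i))"
  by (rule module.scale_sum_right)
    (use vector_space_pm_scale in \<open>simp add: vector_space_def module_def\<close>)

lemma tensor_br_scale_left:
  assumes "f \<in> tensor_carrier L" "g \<in> tensor_carrier L"
  shows "tensor_br br (pm_scale scale c f) g = pm_scale scale c (tensor_br br f g)"
proof -
  have "Poly_Mapping.keys (pm_scale scale c f) \<subseteq> Poly_Mapping.keys f"
    by (auto simp: in_keys_iff)
  then show ?thesis
    using assms
    by (simp add: tensor_br_superset[of _ _ "Poly_Mapping.keys f" "Poly_Mapping.keys g"]
        tensor_carrier_scale br_scale_left lookup_carrier pm_scale_sum)
qed

lemma tensor_br_scale_right:
  assumes "f \<in> tensor_carrier L" "g \<in> tensor_carrier L"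
  shows "tensor_br br f (pm_scale scale c g) = pm_scale scale c (tensor_br br f g)"
proof -
  have "Poly_Mapping.keys (pm_scale scale c g) \<subseteq> Poly_Mapping.keys g"
    by (auto simp: in_keys_iff)
  then show ?thesis
    using assms
    by (simp add: tensor_br_superset[of _ _ "Poly_Mapping.keys f" "Poly_Mapping.keys g"]
        tensor_carrier_scale br_scale_right lookup_carrier pm_scale_sum)
qed

lemma tensor_br_closed:
  assumes "f \<in> tensor_carrier L" "g \<in> tensor_carrier L"
  shows "tensor_br br f g \<in> tensor_carrier L"
  unfolding tensor_br_def
  using assms by (intro tensor_carrier_sum tensor_carrier_single br_closed lookup_carrier)

lemma tensor_br_self:
  assumes f: "f \<in> tensor_carrier L"
  shows "tensor_br br f f = (0 :: 'q::ab_group_add \<Rightarrow>\<^sub>0 'v)"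
proof -
  let ?l = "Poly_Mapping.lookup f"
  let ?m = "\<lambda>\<alpha> \<beta>. Poly_Mapping.single (\<alpha> + \<beta>) (br (?l \<alpha>) (?l \<beta>))"
  have diag: "?m \<alpha> \<alpha> = 0" and anti: "?m \<beta> \<alpha> = - ?m \<alpha> \<beta>" for \<alpha> \<beta>
    using br_anti[of "?l \<alpha>" "?l \<beta>"]
    by (simp_all add: br_self lookup_carrier[OF f] single_uminus add.commute)
  have "(\<Sum>\<alpha>\<in>S. \<Sum>\<beta>\<in>S. ?m \<alpha> \<beta>) = 0" if "finite S" for S
    using that
  proof (induction S)
    case (insert \<gamma> S)
    have "(\<Sum>\<alpha>\<in>S. ?m \<alpha> \<gamma>) = - (\<Sum>\<beta>\<in>S. ?m \<gamma> \<beta>)"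
      unfolding sum_negf[symmetric] by (rule sum.cong[OF refl anti])
    with insert show ?case
      by (simp add: sum.distrib diag)
  qed simp
  then show ?thesis
    by (simp add: tensor_br_def)
qed

lemma tensor_br_sum_left:
  assumes "\<And>i. i \<in> S \<Longrightarrow> F i \<in> tensor_carrier L" "g \<in> tensor_carrier L"
  shows "tensor_br br (sum F S) g = (\<Sum>i\<in>S. tensor_br br (F i) g)"
  using assms
proof (induction S rule: infinite_finite_induct)
  case (insert i S)
  then show ?case
    by (simp add: tensor_br_add_left tensor_carrier_sum)
qed (simp_all add: tensor_br_def)

lemma tensor_br_sum_right:
  assumes "\<And>i. i \<in> S \<Longrightarrow> F i \<in> tensor_carrier L" "g \<in> tensor_carrier L"
  shows "tensor_br br g (sum F S) = (\<Sum>i\<in>S. tensor_br br g (F i))"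
  using assms
proof (induction S rule: infinite_finite_induct)
  case (insert i S)
  then show ?case
    by (simp add: tensor_br_add_right tensor_carrier_sum)
qed (simp_all add: tensor_br_def)

lemma tensor_br_triple:
  assumes f: "f \<in> tensor_carrier L" and g: "g \<in> tensor_carrier L" and h: "h \<in> tensor_carrier L"
  shows "tensor_br br f (tensor_br br g h) =
    (\<Sum>\<alpha>\<in>Poly_Mapping.keys f. \<Sum>\<beta>\<in>Poly_Mapping.keys g. \<Sum>\<gamma>\<in>Poly_Mapping.keys h.
      Poly_Mapping.single (\<alpha> + (\<beta> + \<gamma>))
        (br (Poly_Mapping.lookup f \<alpha>) (br (Poly_Mapping.lookup g \<beta>) (Poly_Mapping.lookup h \<gamma>))))"
proof -
  note cl = tensor_carrier_single tensor_carrier_sum br_closed lookup_carrier f g h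
  have "tensor_br br f (tensor_br br g h) =
     tensor_br br (\<Sum>\<alpha>\<in>Poly_Mapping.keys f. Poly_Mapping.single \<alpha> (Poly_Mapping.lookup f \<alpha>))
       (tensor_br br g h)"
    using pm_sum_singles[of "Poly_Mapping.keys f" f] by simp
  also have "\<dots> = (\<Sum>\<alpha>\<in>Poly_Mapping.keys f.
      tensor_br br (Poly_Mapping.single \<alpha> (Poly_Mapping.lookup f \<alpha>)) (tensor_br br g h))"
    by (rule tensor_br_sum_left) (simp_all add: cl tensor_br_closed)
  also have "\<dots> = (\<Sum>\<alpha>\<in>Poly_Mapping.keys f. \<Sum>\<beta>\<in>Poly_Mapping.keys g. \<Sum>\<gamma>\<in>Poly_Mapping.keys h.
      Poly_Mapping.single (\<alpha> + (\<beta> + \<gamma>))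
        (br (Poly_Mapping.lookup f \<alpha>) (br (Poly_Mapping.lookup g \<beta>) (Poly_Mapping.lookup h \<gamma>))))"
    unfolding tensor_br_def[of br g h]
    by (simp add: tensor_br_sum_right cl)
  finally show ?thesis .
qed

lemma tensor_br_jacobi:
  fixes f g h :: "'q::ab_group_add \<Rightarrow>\<^sub>0 'v"
  assumes f: "f \<in> tensor_carrier L" and g: "g \<in> tensor_carrier L" and h: "h \<in> tensor_carrier L"
  shows "tensor_br br f (tensor_br br g h) + tensor_br br g (tensor_br br h f) +
    tensor_br br h (tensor_br br f g) = 0"
proof -
  let ?F = "Poly_Mapping.lookup f" and ?G = "Poly_Mapping.lookup g" and ?H = "Poly_Mapping.lookup h"
  let ?f = "Poly_Mapping.keys f" and ?g = "Poly_Mapping.keys g" and ?h = "Poly_Mapping.keys h"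
  let ?s = "\<lambda>\<alpha> \<beta> \<gamma>. Poly_Mapping.single (\<alpha> + (\<beta> + \<gamma>)) :: 'v \<Rightarrow> 'q \<Rightarrow>\<^sub>0 'v"
  have 2: "tensor_br br g (tensor_br br h f) =
      (\<Sum>\<alpha>\<in>?f. \<Sum>\<beta>\<in>?g. \<Sum>\<gamma>\<in>?h. ?s \<alpha> \<beta> \<gamma> (br (?G \<beta>) (br (?H \<gamma>) (?F \<alpha>))))"
  proof -
    have "tensor_br br g (tensor_br br h f) =
        (\<Sum>\<beta>\<in>?g. \<Sum>\<gamma>\<in>?h. \<Sum>\<alpha>\<in>?f. ?s \<alpha> \<beta> \<gamma> (br (?G \<beta>) (br (?H \<gamma>) (?F \<alpha>))))"
      by (simp add: tensor_br_triple[OF g h f] ac_simps)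
    also have "\<dots> = (\<Sum>\<beta>\<in>?g. \<Sum>\<alpha>\<in>?f. \<Sum>\<gamma>\<in>?h. ?s \<alpha> \<beta> \<gamma> (br (?G \<beta>) (br (?H \<gamma>) (?F \<alpha>))))"
      by (rule sum.cong[OF refl sum.swap])
    also have "\<dots> = (\<Sum>\<alpha>\<in>?f. \<Sum>\<beta>\<in>?g. \<Sum>\<gamma>\<in>?h. ?s \<alpha> \<beta> \<gamma> (br (?G \<beta>) (br (?H \<gamma>) (?F \<alpha>))))"
      by (rule sum.swap)
    finally show ?thesis .
  qed
  have 3: "tensor_br br h (tensor_br br f g) =
      (\<Sum>\<alpha>\<in>?f. \<Sum>\<beta>\<in>?g. \<Sum>\<gamma>\<in>?h. ?s \<alpha> \<beta> \<gamma> (br (?H \<gamma>) (br (?F \<alpha>) (?G \<beta>))))"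
  proof -
    have "tensor_br br h (tensor_br br f g) =
        (\<Sum>\<gamma>\<in>?h. \<Sum>\<alpha>\<in>?f. \<Sum>\<beta>\<in>?g. ?s \<alpha> \<beta> \<gamma> (br (?H \<gamma>) (br (?F \<alpha>) (?G \<beta>))))"
      by (simp add: tensor_br_triple[OF h f g] ac_simps)
    also have "\<dots> = (\<Sum>\<alpha>\<in>?f. \<Sum>\<gamma>\<in>?h. \<Sum>\<beta>\<in>?g. ?s \<alpha> \<beta> \<gamma> (br (?H \<gamma>) (br (?F \<alpha>) (?G \<beta>))))"
      by (rule sum.swap)
    also have "\<dots> = (\<Sum>\<alpha>\<in>?f. \<Sum>\<beta>\<in>?g. \<Sum>\<gamma>\<in>?h. ?s \<alpha> \<beta> \<gamma> (br (?H \<gamma>) (br (?F \<alpha>) (?G \<beta>))))"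
      by (rule sum.cong[OF refl sum.swap])
    finally show ?thesis .
  qed
  show ?thesis
    unfolding 2 3 tensor_br_triple[OF f g h] sum.distrib[symmetric]
    by (simp add: jacobi lookup_carrier f g h flip: single_add)
qed

lemma tensor_br_tensor:
  fixes p q :: "'q::ab_group_add \<Rightarrow>\<^sub>0 'k"
  assumes x: "x \<in> L" and y: "y \<in> L"
  shows "tensor_br br (tensor scale x p) (tensor scale y q) = tensor scale (br x y) (p * q)"
proof -
  let ?l = "Poly_Mapping.lookup :: ('q \<Rightarrow>\<^sub>0 'k) \<Rightarrow> _" and ?k = "Poly_Mapping.keys :: ('q \<Rightarrow>\<^sub>0 'k) \<Rightarrow> _"
  let ?s = "Poly_Mapping.single :: 'q \<Rightarrow> 'k \<Rightarrow> 'q \<Rightarrow>\<^sub>0 'k"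
  have tc: "tensor scale z r \<in> tensor_carrier L" if "z \<in> L" for z and r :: "'q \<Rightarrow>\<^sub>0 'k"
    using that by (simp add: tensor_carrier_def subspace_scale[OF subspace_carrier])
  have k: "Poly_Mapping.keys (tensor scale z r) \<subseteq> ?k r" for z and r :: "'q \<Rightarrow>\<^sub>0 'k"
    by (auto simp: in_keys_iff)
  have tadd: "tensor scale z (r + r') = tensor scale z r + tensor scale z r'"
    for z and r r' :: "'q \<Rightarrow>\<^sub>0 'k"
    by (rule poly_mapping_eqI) (simp add: lookup_add scale_left_distrib)
  have tzero: "tensor scale z (0 :: 'q \<Rightarrow>\<^sub>0 'k) = 0" for z
    by (rule poly_mapping_eqI) simp
  have tsum: "tensor scale z (\<Sum>i\<in>S. F i) = (\<Sum>i\<in>S. tensor scale z (F i))"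
    for z S and F :: "'q \<Rightarrow> 'q \<Rightarrow>\<^sub>0 'k"
    by (induction S rule: infinite_finite_induct) (simp_all add: tadd tzero)
  have "p * q = (\<Sum>\<alpha>\<in>?k p. ?s \<alpha> (?l p \<alpha>)) * (\<Sum>\<beta>\<in>?k q. ?s \<beta> (?l q \<beta>))"
    using pm_sum_singles[of "?k p" p] pm_sum_singles[of "?k q" q] by simp
  also have "\<dots> = (\<Sum>\<alpha>\<in>?k p. \<Sum>\<beta>\<in>?k q. ?s (\<alpha> + \<beta>) (?l p \<alpha> * ?l q \<beta>))"
    by (simp add: sum_product mult_single)
  finally have "tensor scale (br x y) (p * q) =
      (\<Sum>\<alpha>\<in>?k p. \<Sum>\<beta>\<in>?k q. Poly_Mapping.single (\<alpha> + \<beta>) ((?l p \<alpha> * ?l q \<beta>) *s br x y))"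
    by (simp add: tsum)
  also have "\<dots> = tensor_br br (tensor scale x p) (tensor scale y q)"
    using x y
    by (simp add: tensor_br_superset[OF tc tc _ k _ k] br_scale_left br_scale_right
        subspace_scale[OF subspace_carrier] mult.commute)
  finally show ?thesis ..
qed

lemma tensor_lie_algebra:
  "lie_algebra (pm_scale scale) (tensor_carrier L) (tensor_br br :: ('q::ab_group_add \<Rightarrow>\<^sub>0 'v) \<Rightarrow> _)"
proof -
  interpret t: vector_space "pm_scale scale :: 'k \<Rightarrow> ('q \<Rightarrow>\<^sub>0 'v) \<Rightarrow> _"
    by (rule vector_space_pm_scale)
  show ?thesis
    by unfold_locales
      (auto simp: t.subspace_def tensor_carrier_zero tensor_carrier_add tensor_carrier_scale
        tensor_br_closed tensor_br_add_left tensor_br_add_right tensor_br_scale_left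
        tensor_br_scale_right tensor_br_self tensor_br_jacobi)
qed

end


subsection \<open>The loop algebra is a graded Lie algebra\<close>

lemma (in graded_lie_algebra) component_subset: "i \<in> I \<Longrightarrow> D i \<subseteq> L"
  using direct_sum by (simp add: is_direct_sum_def)

lemma loop_graded:
  fixes P :: "'q::ab_group_add set"
  assumes P: "is_subgroup P"
    and "graded_lie_algebra scale A br (quotient_group P) E"
  shows "graded_lie_algebra (pm_scale scale) (loop_carrier P E) (tensor_br br)
    UNIV (loop_component P E)"
proof -
  interpret graded_lie_algebra scale A br "quotient_group P" E by fact
  interpret t: lie_algebra "pm_scale scale :: _ \<Rightarrow> ('q \<Rightarrow>\<^sub>0 _) \<Rightarrow> _" "tensor_carrier A" "tensor_br br"
    by (rule tensor_lie_algebra)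
  let ?l = Poly_Mapping.lookup and ?s = Poly_Mapping.single
  have coset: "\<alpha> +o P \<in> quotient_group P" for \<alpha>
    by (simp add: quotient_group_def)
  note sub = subspace_component[OF coset]
  have sub_tensor: "f \<in> tensor_carrier A" if "f \<in> loop_carrier P E" for f
    using that component_subset[OF coset] by (auto simp: loop_carrier_def tensor_carrier_def)
  have car: "t.subspace (loop_carrier P E)"
    by (auto simp: t.subspace_def loop_carrier_def lookup_add subspace_0[OF sub]
        subspace_add[OF sub] subspace_scale[OF sub])
  have sgl: "?s \<alpha> x \<in> loop_carrier P E" if "x \<in> E (\<alpha> +o P)" for \<alpha> x
    using that by (simp add: loop_carrier_def lookup_single when_def subspace_0[OF sub])
  have brE: "br x y \<in> E ((\<alpha> + \<beta>) +o P)" if "x \<in> E (\<alpha> +o P)" "y \<in> E (\<beta> +o P)" for x y \<alpha> \<beta>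
    using br_component[OF coset coset that] by (simp add: coset_add[OF P])
  have brcl: "tensor_br br f g \<in> loop_carrier P E"
    if "f \<in> loop_carrier P E" "g \<in> loop_carrier P E" for f g
    unfolding tensor_br_def using that
    by (intro t.subspace_sum[OF car] sgl brE) (auto simp: loop_carrier_def)
  have comp: "t.subspace (loop_component P E \<alpha>)" for \<alpha>
    unfolding t.subspace_def loop_component_def
    by (auto simp: image_iff subspace_0[OF sub] simp flip: single_add
        intro: subspace_add[OF sub] subspace_scale[OF sub] bexI[of _ 0])
  have "is_direct_sum UNIV (loop_component P E) (loop_carrier P E)"
    unfolding is_direct_sum_def
  proof (intro conjI ballI)
    show "loop_component P E \<alpha> \<subseteq> loop_carrier P E" for \<alpha>
      by (auto simp: loop_component_def sgl)
    fix f assume f: "f \<in> loop_carrier P E"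
    show "\<exists>!F. finite {\<alpha>. F \<alpha> \<noteq> 0} \<and> (\<forall>\<alpha>\<in>UNIV. F \<alpha> \<in> loop_component P E \<alpha>) \<and>
      (\<forall>\<alpha>. \<alpha> \<notin> UNIV \<longrightarrow> F \<alpha> = 0) \<and> f = (\<Sum>\<alpha> | F \<alpha> \<noteq> 0. F \<alpha>)"
    proof (rule ex1I[of _ "\<lambda>\<alpha>. ?s \<alpha> (?l f \<alpha>)"], goal_cases)
      case 1
      have nz: "{\<alpha>. ?s \<alpha> (?l f \<alpha>) \<noteq> 0} = Poly_Mapping.keys f"
        by (metis (mono_tags, lifting) Collect_cong in_keys_iff lookup_single_eq lookup_zero
            single_zero Collect_mem_eq)
      show ?case
        using f pm_sum_singles[of "Poly_Mapping.keys f" f]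
        by (auto simp: nz loop_component_def loop_carrier_def)
    next
      case (2 F)
      then have fin: "finite {\<alpha>. F \<alpha> \<noteq> 0}" and f_eq: "f = (\<Sum>\<alpha> | F \<alpha> \<noteq> 0. F \<alpha>)"
        and "\<forall>\<alpha>. \<exists>x. F \<alpha> = ?s \<alpha> x"
        by (auto simp: loop_component_def)
      then obtain x where x: "F \<alpha> = ?s \<alpha> (x \<alpha>)" for \<alpha>
        by metis
      have "?l f \<beta> = x \<beta>" for \<beta>
      proof -
        have "?l f \<beta> = (\<Sum>\<alpha> | F \<alpha> \<noteq> 0. x \<alpha> when \<alpha> = \<beta>)"
          unfolding f_eq by (simp add: lookup_sum x lookup_single)
        also have "\<dots> = (if F \<beta> \<noteq> 0 then x \<beta> else 0)"
          unfolding when_def using fin by (simp add: sum.delta')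
        also have "\<dots> = x \<beta>"
          by (metis x lookup_single_eq lookup_zero)
        finally show ?thesis .
      qed
      then show ?case
        by (simp add: x fun_eq_iff)
    qed
  qed
  moreover have "tensor_br br f g \<in> loop_component P E (\<alpha> + \<beta>)"
    if "f \<in> loop_component P E \<alpha>" "g \<in> loop_component P E \<beta>" for f g \<alpha> \<beta>
  proof -
    from that obtain x y where "x \<in> E (\<alpha> +o P)" "y \<in> E (\<beta> +o P)" "f = ?s \<alpha> x" "g = ?s \<beta> y"
      by (auto simp: loop_component_def)
    with component_subset[OF coset] show ?thesis
      by (auto simp: loop_component_def subset_iff brE intro!: imageI)
  qed
  ultimately show ?thesis
    using car brcl comp sub_tensor
    by unfold_locales
      (simp_all add: t.br_add_left t.br_add_right t.br_scale_left t.br_scale_right t.br_self t.jacobi)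
qed

end

theory Submission
  imports Defs "HOL-Algebra.Coset"
begin

text \<open>
  The centroid of a Lie algebra consists of the linear maps commuting with all left multiplications.
  In a graded simple algebra the kernel and the image of a homogeneous centroid element are graded
  ideals, so the nonzero ones are invertible (\<open>centroidal_bij\<close>), and they commute with each other
  (\<open>centroidal_commute\<close>). If one of degree \<open>0\<close> were not a scalar, its resolvents, applied to
  a fixed vector, would form a linearly independent family indexed by the field, which
  \<open>dim \<gg> < |\<Bbbk>|\<close> excludes (\<open>centroidal_0_scalar\<close>). So the nonzero homogeneous centroid elements form
  an abelian group that is an extension of a subgroup \<open>P\<close> of \<open>Q\<close>, the group of their degrees, by the
  multiplicative group of \<open>\<Bbbk>\<close>. The latter is divisible because \<open>\<Bbbk>\<close> is algebraically closed, hence the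
  extension splits (\<open>divisible_subgroup_has_complement\<close>, \<open>centroid_splits\<close>): there are centroid
  elements \<open>c\<^sub>\<gamma>\<close> of degree \<open>\<gamma> \<in> P\<close> with \<open>c\<^sub>\<gamma>\<^sub>+\<^sub>\<delta> = c\<^sub>\<gamma> c\<^sub>\<delta>\<close>.

  The algebra \<open>\<aa>\<close> is the quotient of \<open>\<gg>\<close> by the ideal spanned by all \<open>c\<^sub>\<gamma> v - v\<close>. The quotient map
  is bijective on each \<open>\<gg>\<^sub>\<alpha>\<close> and identifies exactly the components with degrees in one coset of \<open>P\<close>,
  so \<open>\<aa>\<close> is graded by \<open>Q/P\<close>, and keeping track of the degree identifies \<open>\<gg>\<close> with the loop algebra
  (\<open>to_loop_iso\<close>).

  It remains to see that \<open>\<aa>\<close> is simple without reference to the grading (\<open>A_simple_ideal\<close>). Take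
  a nonzero element of an ideal with the fewest homogeneous components. If it had more than one,
  minimality would make the passage from one to another a centroid element
  (\<open>ex_centroidal_between\<close>) whose degree is not in \<open>P\<close>, which is absurd. So the ideal contains a nonzero homogeneous element, and
  graded simplicity of \<open>\<gg>\<close> makes it all of \<open>\<aa>\<close>.
\<close>

section \<open>Complements of divisible subgroups\<close>

text \<open>
  Divisible abelian groups are injective. For a subgroup \<open>S\<close> maximal among those meeting \<open>K\<close>
  trivially, an element \<open>z\<close> outside \<open>S K\<close> would be correctable by a suitable \<open>k \<in> K\<close> such that
  \<open>S\<close> and \<open>z k\<close> together still generate a subgroup that meets \<open>K\<close> trivially: if \<open>n\<close> is the order
  of \<open>z\<close> modulo \<open>S K\<close>, extracting an \<open>n\<close>-th root in \<open>K\<close> moves \<open>z ^ n\<close> into \<open>S\<close>.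
\<close>

lemma (in comm_group) divisible_subgroup_has_complement:
  assumes K: "subgroup K G"
    and div: "\<And>k n. k \<in> K \<Longrightarrow> 0 < n \<Longrightarrow> \<exists>l\<in>K. l [^] (n :: nat) = k"
  obtains S where "subgroup S G" "S \<inter> K = {\<one>}"
    "\<And>z. z \<in> carrier G \<Longrightarrow> \<exists>s\<in>S. \<exists>k\<in>K. z = s \<otimes> k"
proof -
  let ?F = "{S. subgroup S G \<and> S \<inter> K = {\<one>}}"
  note K1 = subgroup.one_closed[OF K]
  have "\<exists>S\<in>?F. \<forall>X\<in>?F. S \<subseteq> X \<longrightarrow> X = S"
  proof (rule subset_Zorn_nonempty)
    show "?F \<noteq> {}"
      using triv_subgroup K1 by blast
    fix C assume "C \<noteq> {}" and ch: "subset.chain ?F C"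
    then have CF: "\<And>S. S \<in> C \<Longrightarrow> subgroup S G \<and> S \<inter> K = {\<one>}"
      by (auto simp: subset.chain_def)
    have "subgroup (\<Union>C) G"
    proof (rule subgroupI)
      show "\<Union>C \<subseteq> carrier G" using CF by (simp add: Sup_le_iff subgroup.subset)
      show "\<Union>C \<noteq> {}" using \<open>C \<noteq> {}\<close> CF subgroup.one_closed by blast
      show "inv a \<in> \<Union>C" if "a \<in> \<Union>C" for a
        using that CF by (meson UnionE UnionI subgroup.m_inv_closed)
      fix a b assume "a \<in> \<Union>C" "b \<in> \<Union>C"
      then obtain X Y where XY: "X \<in> C" "Y \<in> C" "a \<in> X" "b \<in> Y" by blast
      with ch have "X \<subseteq> Y \<or> Y \<subseteq> X" by (auto simp: subset_chain_def)
      then show "a \<otimes> b \<in> \<Union>C"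
      proof
        assume "X \<subseteq> Y"
        with XY have "a \<in> Y" by blast
        with XY CF[of Y] subgroup.m_closed[of Y G a b] show ?thesis by blast
      next
        assume "Y \<subseteq> X"
        with XY have "b \<in> X" by blast
        with XY CF[of X] subgroup.m_closed[of X G a b] show ?thesis by blast
      qed
    qed
    moreover have "\<Union>C \<inter> K = {\<one>}"
      using \<open>C \<noteq> {}\<close> CF by auto
    ultimately show "\<Union>C \<in> ?F" by simp
  qed
  then obtain S where SF: "S \<in> ?F" and maximal: "\<forall>X\<in>?F. S \<subseteq> X \<longrightarrow> X = S" ..
  have S: "subgroup S G" and SK: "S \<inter> K = {\<one>}"
    using SF by simp_all
  have max: "X = S" if "subgroup X G" "X \<inter> K = {\<one>}" "S \<subseteq> X" for X
    using maximal that by simp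
  define T where "T = S <#> K"
  have T: "subgroup T G"
    unfolding T_def using S K by (rule mult_subgroups)
  have T_iff: "a \<in> T \<longleftrightarrow> (\<exists>s\<in>S. \<exists>k\<in>K. a = s \<otimes> k)" for a
    by (auto simp: T_def set_mult_def)
  note Sc = subgroup.mem_carrier[OF S] and Kc = subgroup.mem_carrier[OF K]
  have ST: "S \<subseteq> T" and KT: "K \<subseteq> T"
    using Sc Kc K1 subgroup.one_closed[OF S] by (force simp: T_iff)+
  have pow_T: "a [^] (m :: int) \<in> T" if "a \<in> T" for a m
    using that int_pow_consistent[OF T that] group.int_pow_closed[OF subgroup_imp_group[OF T], of a m] by simp
  have "\<exists>s\<in>S. \<exists>k\<in>K. z = s \<otimes> k" if z: "z \<in> carrier G" for z
  proof -
    \<comment> \<open>Every power of the corrected element that falls into \<open>S K\<close> already lies in \<open>S\<close>.\<close>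
    have "\<exists>k\<in>K. \<forall>m::int. (z \<otimes> k) [^] m \<in> T \<longrightarrow> (z \<otimes> k) [^] m \<in> S"
    proof (cases "\<exists>n::nat. 0 < n \<and> z [^] n \<in> T")
      case False
      have "m = 0" if m: "z [^] (m :: int) \<in> T" for m
      proof (rule ccontr)
        assume "m \<noteq> 0"
        have "z [^] \<bar>m\<bar> \<in> T"
          using m subgroup.m_inv_closed[OF T m] z by (auto simp: abs_if int_pow_neg)
        then have "z [^] nat \<bar>m\<bar> \<in> T"
          by (simp flip: int_pow_int)
        with False \<open>m \<noteq> 0\<close> show False
          by (metis zero_less_abs_iff zero_less_nat_eq)
      qed
      then have "\<forall>m::int. (z \<otimes> \<one>) [^] m \<in> T \<longrightarrow> (z \<otimes> \<one>) [^] m \<in> S"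
        using z subgroup.one_closed[OF S] by (metis int_pow_0 r_one)
      with K1 show ?thesis by blast
    next
      case True
      define n where "n = (LEAST n::nat. 0 < n \<and> z [^] n \<in> T)"
      have n: "0 < n" "z [^] n \<in> T"
        using LeastI_ex[OF True] by (auto simp: n_def)
      have n_min: "r = 0" if "r < n" "z [^] r \<in> T" for r :: nat
        using that not_less_Least[of r "\<lambda>n. 0 < n \<and> z [^] n \<in> T"] by (auto simp: n_def)
      obtain s k where s: "s \<in> S" and k: "k \<in> K" and zn: "z [^] n = s \<otimes> k"
        using n(2) by (auto simp: T_iff)
      obtain l where l: "l \<in> K" and ln: "l [^] n = inv k"
        using div[OF subgroup.m_inv_closed[OF K k] n(1)] by blast
      have zl: "z \<otimes> l \<in> carrier G"
        using z Kc[OF l] by simp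
      have zln: "(z \<otimes> l) [^] n = s"
        using z Kc[OF l] Kc[OF k] Sc[OF s] by (simp add: pow_mult_distrib[OF m_comm] zn ln m_assoc)
      have "(z \<otimes> l) [^] m \<in> S" if m: "(z \<otimes> l) [^] (m :: int) \<in> T" for m
      proof -
        let ?q = "m div int n" and ?r = "m mod int n"
        have mqr: "m = int n * ?q + ?r" by simp
        have "(z \<otimes> l) [^] m = z [^] m \<otimes> l [^] m"
          using z Kc[OF l] by (simp add: int_pow_distrib)
        then have "z [^] m = (z \<otimes> l) [^] m \<otimes> inv (l [^] m)"
          using z Kc[OF l] by (simp add: m_assoc)
        moreover have "inv (l [^] m) \<in> T"
          using KT l pow_T subgroup.m_inv_closed[OF T] by blast
        ultimately have zm: "z [^] m \<in> T"
          using m subgroup.m_closed[OF T] by metis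
        \<comment> \<open>\<open>n\<close> divides \<open>m\<close>, since the remainder contradicts the minimality of \<open>n\<close>.\<close>
        have "z [^] ?r = z [^] m \<otimes> inv (z [^] (int n * ?q))"
          using z by (subst int_pow_diff[symmetric]) (simp_all add: minus_mult_div_eq_mod)
        also have "z [^] (int n * ?q) = (z [^] n) [^] ?q"
          using z by (simp add: int_pow_pow flip: int_pow_int)
        finally have "z [^] nat ?r \<in> T"
          using zm pow_T[OF n(2)] subgroup.m_inv_closed[OF T] subgroup.m_closed[OF T] n(1)
          by (simp flip: int_pow_int)
        then have "nat ?r = 0"
          using n(1) by (intro n_min) (auto simp: nat_less_iff)
        then have "m = int n * ?q"
          using n(1) mqr by (simp add: nat_eq_iff) 
        then have "(z \<otimes> l) [^] m = s [^] ?q"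
          using zl zln by (metis int_pow_pow int_pow_int)
        then show ?thesis
          using int_pow_consistent[OF S s, of ?q]
            group.int_pow_closed[OF subgroup_imp_group[OF S], of s ?q] s by simp
      qed
      with l show ?thesis by blast
    qed
    then obtain k where k: "k \<in> K" and zk: "\<And>m::int. (z \<otimes> k) [^] m \<in> T \<Longrightarrow> (z \<otimes> k) [^] m \<in> S"
      by blast
    let ?y = "z \<otimes> k"
    have y: "?y \<in> carrier G" using z Kc[OF k] by simp
    define R where "R = S <#> range (\<lambda>m::int. ?y [^] m)"
    have R_iff: "a \<in> R \<longleftrightarrow> (\<exists>s\<in>S. \<exists>m::int. a = s \<otimes> ?y [^] m)" for a
      by (auto simp: R_def set_mult_def)
    have "subgroup (range (\<lambda>m::int. ?y [^] m)) G"
      using y by (intro subgroupI) (auto simp flip: int_pow_neg int_pow_mult)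
    then have "subgroup R G"
      unfolding R_def using S by (intro mult_subgroups)
    moreover have "R \<inter> K = {\<one>}"
    proof (intro equalityI subsetI)
      fix a assume "a \<in> R \<inter> K"
      then obtain s m where s: "s \<in> S" and a: "a = s \<otimes> ?y [^] (m::int)" and aK: "a \<in> K"
        by (auto simp: R_iff)
      then have "?y [^] m = inv s \<otimes> a"
        using Sc y by (simp add: inv_solve_left)
      then have "?y [^] m \<in> T"
        using s aK subgroup.m_inv_closed[OF S s] by (auto simp: T_iff)
      then have "a \<in> S"
        unfolding a by (intro subgroup.m_closed[OF S] s zk)
      with aK SK show "a \<in> {\<one>}" by blast
    next
      show "a \<in> R \<inter> K" if "a \<in> {\<one>}" for a
        using that \<open>subgroup R G\<close> K1 subgroup.one_closed by blast
    qed
    moreover have "S \<subseteq> R"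
      using Sc by (force simp: R_iff intro: exI[of _ "0::int"])
    ultimately have "R = S" by (rule max)
    moreover have "?y \<in> R"
      using y subgroup.one_closed[OF S] by (force simp: R_iff intro: exI[of _ "1::int"])
    ultimately have "?y \<in> S" by simp
    moreover have "z = ?y \<otimes> inv k"
      using z Kc[OF k] by (simp add: m_assoc)
    ultimately show ?thesis
      using subgroup.m_inv_closed[OF K k] by blast
  qed
  with S SK that show thesis by blast
qed

section \<open>Resolvents of an endomorphism\<close>

locale endomorphism = vector_space scale
  for scale :: "'k::field \<Rightarrow> 'v::ab_group_add \<Rightarrow> 'v" +
  fixes T :: "'v \<Rightarrow> 'v"
  assumes T_add: "T (v + w) = T v + T w"
    and T_scale: "T (scale c v) = scale c (T v)"
begin

lemma T_0 [simp]: "T 0 = 0"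
  using T_add[of 0 0] by simp

text \<open>The operator obtained by evaluating a polynomial at \<open>T\<close>, by Horner's scheme.\<close>

definition poly_of :: "'k poly \<Rightarrow> 'v \<Rightarrow> 'v" where
  "poly_of p = fold_coeffs (\<lambda>a g v. scale a v + T (g v)) p (\<lambda>_. 0)"

lemma poly_of_0 [simp]: "poly_of 0 v = 0"
  by (simp add: poly_of_def)

lemma poly_of_pCons [simp]: "poly_of (pCons a p) v = scale a v + T (poly_of p v)"
  by (cases "p = 0 \<and> a = 0") (auto simp: poly_of_def fold_coeffs_pCons_coeff_not_0_eq
      fold_coeffs_pCons_not_0_0_eq)

lemma poly_of_add: "poly_of (p + q) v = poly_of p v + poly_of q v"
  by (induction p q rule: poly_induct2) (simp_all add: T_add scale_left_distrib)

lemma poly_of_smult: "poly_of (smult a p) v = scale a (poly_of p v)"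
  by (induction p) (simp_all add: T_scale scale_right_distrib)

lemma poly_of_vec_add: "poly_of p (v + w) = poly_of p v + poly_of p w"
  by (induction p) (simp_all add: T_add scale_right_distrib)

lemma poly_of_vec_scale: "poly_of p (scale c v) = scale c (poly_of p v)"
  by (induction p) (simp_all add: T_scale scale_right_distrib mult.commute)

lemma poly_of_mult: "poly_of (p * q) v = poly_of p (poly_of q v)"
  by (induction p) (simp_all add: poly_of_add poly_of_smult)

lemma poly_of_linear_factor: "poly_of [:- \<mu>, 1:] v = T v - scale \<mu> v"
  by simp

lemma poly_of_sum: "poly_of (sum p F) v = (\<Sum>i\<in>F. poly_of (p i) v)"
  by (induction F rule: infinite_finite_induct) (simp_all add: poly_of_add)

lemma poly_of_vec_sum: "poly_of p (sum v F) = (\<Sum>i\<in>F. poly_of p (v i))"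
proof (induction F rule: infinite_finite_induct)
  case empty
  show ?case using poly_of_vec_scale[of p 0 0] by simp
qed (use poly_of_vec_scale[of p 0 0] in \<open>simp_all add: poly_of_vec_add\<close>)

end

text \<open>
  Over an algebraically closed field every polynomial in \<open>T\<close> is a product of operators
  \<open>T - \<mu>\<close>, so it is injective as soon as \<open>T\<close> has no eigenvalue.
\<close>

lemma poly_of_nonzero:
  fixes s :: "'k::alg_closed_field \<Rightarrow> 'v::ab_group_add \<Rightarrow> 'v"
  assumes "endomorphism s T"
    and inj: "\<And>\<mu> v. T v = s \<mu> v \<Longrightarrow> v = 0"
    and "p \<noteq> 0" "v \<noteq> 0"
  shows "endomorphism.poly_of s T p v \<noteq> 0"
proof -
  interpret endomorphism s T by fact
  obtain A where A: "p = smult (lead_coeff p) (\<Prod>x\<in>#A. [:- x, 1:])"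
    using alg_closed_imp_factorization[OF \<open>p \<noteq> 0\<close>] by blast
  have "poly_of (\<Prod>x\<in>#A. [:- x, 1:]) v \<noteq> 0"
  proof (induction A)
    case empty
    have "poly_of 1 v = v"
      by (simp add: one_pCons)
    with \<open>v \<noteq> 0\<close> show ?case by simp
  next
    case (add \<mu> A)
    then show ?case
      using inj
        by (auto simp: poly_of_mult poly_of_linear_factor simp del: poly_of_pCons mult_pCons_left)
  qed
  with \<open>p \<noteq> 0\<close> show ?thesis
    by (subst A) (simp add: poly_of_smult)
qed

text \<open>
  Multiplying a relation between the vectors \<open>(T - \<mu>)\<^bsup>-1\<^esup> x\<close> by the product of all \<open>T - \<mu>\<close> involved
  turns it into \<open>p(T) x = 0\<close>. Then \<open>p = 0\<close>, and evaluating \<open>p\<close> at each \<open>\<mu>\<close> isolates one coefficient: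
  this is uniqueness of partial fractions.
\<close>

lemma resolvents_independent:
  fixes s :: "'k::alg_closed_field \<Rightarrow> 'v::ab_group_add \<Rightarrow> 'v" and x :: 'v
  assumes "endomorphism s T"
    and inj: "\<And>\<mu> v. T v = s \<mu> v \<Longrightarrow> v = 0"
    and y: "\<And>\<mu>. T (y \<mu>) - s \<mu> (y \<mu>) = x"
    and "x \<noteq> 0"
  shows "Modules.module.independent s (range y)" "inj y"
proof -
  interpret endomorphism s T by fact
  show inj_y: "inj y"
  proof (rule injI)
    fix \<kappa> \<mu> assume "y \<kappa> = y \<mu>"
    with y[of \<kappa>] y[of \<mu>] have "s \<kappa> (y \<kappa>) = s \<mu> (y \<kappa>)"
      by (metis diff_add_cancel add_diff_cancel_left' diff_eq_eq)
    moreover have "y \<kappa> \<noteq> 0" using y[of \<kappa>] \<open>x \<noteq> 0\<close> by auto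
    ultimately show "\<kappa> = \<mu>" by (simp)
  qed
  show "independent (range y)"
    unfolding independent_explicit_module
  proof (intro allI impI)
    fix t u v assume t: "finite t" "t \<subseteq> range y" and z: "(\<Sum>v\<in>t. s (u v) v) = 0" and "v \<in> t"
    define F where "F = y -` t"
    have F: "finite F"
      unfolding F_def using t(1) inj_y by (rule finite_vimageI)
    have tF: "t = y ` F"
      using t(2) by (auto simp: F_def)
    let ?q = "\<lambda>G. \<Prod>\<mu>\<in>G. [:- \<mu>, 1:]"
    have q: "poly_of (?q F) (y \<mu>) = poly_of (?q (F - {\<mu>})) x" if "\<mu> \<in> F" for \<mu>
    proof -
      have "?q F = ?q (F - {\<mu>}) * [:- \<mu>, 1:]"
        using prod.remove[OF F that, of "\<lambda>\<mu>. [:- \<mu>, 1:]"] by (simp add: mult.commute)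
      then show ?thesis
        using y[of \<mu>]
          by (simp add: poly_of_mult poly_of_linear_factor del: poly_of_pCons mult_pCons_left mult_pCons_right)
    qed
    let ?p = "\<Sum>\<mu>\<in>F. smult (u (y \<mu>)) (?q (F - {\<mu>}))"
    have "(\<Sum>\<mu>\<in>F. s (u (y \<mu>)) (y \<mu>)) = 0"
      using z sum.reindex[OF inj_on_subset[OF inj_y subset_UNIV], of "\<lambda>v. s (u v) v" F]
      by (simp add: tF)
    then have "0 = poly_of (?q F) (\<Sum>\<mu>\<in>F. s (u (y \<mu>)) (y \<mu>))"
      using poly_of_vec_sum[of "?q F" "\<lambda>_. 0" "{}"] by simp
    also have "\<dots> = poly_of ?p x"
      by (simp add: poly_of_vec_sum poly_of_vec_scale poly_of_sum poly_of_smult q)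
    finally have "?p = 0"
      using poly_of_nonzero[OF \<open>endomorphism s T\<close> inj _ \<open>x \<noteq> 0\<close>, where p = ?p] by fastforce
    obtain \<kappa> where \<kappa>: "\<kappa> \<in> F" "v = y \<kappa>"
      using \<open>v \<in> t\<close> tF by auto
    have "0 = poly ?p \<kappa>"
      using \<open>?p = 0\<close> by simp
    also have "\<dots> = (\<Sum>\<mu>\<in>F. u (y \<mu>) * (\<Prod>\<nu>\<in>F - {\<mu>}. \<kappa> - \<nu>))"
      by (simp add: poly_sum poly_prod)
    also have "\<dots> = (\<Sum>\<mu>\<in>{\<kappa>}. u (y \<mu>) * (\<Prod>\<nu>\<in>F - {\<mu>}. \<kappa> - \<nu>))"
      using F \<kappa> by (intro sum.mono_neutral_right) auto
    finally show "u v = 0"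
      using F \<kappa> by auto
  qed
qed

lemma (in vector_space) independent_lepoll_basis:
  assumes "independent S" "independent B" "span B = UNIV"
  shows "S \<lesssim> B"
proof -
  obtain C where C: "S \<subseteq> C" "independent C" "UNIV \<subseteq> span C"
    using maximal_independent_subset_extend[OF subset_UNIV assms(1)] by metis
  then obtain f where "bij_betw f C B"
    using bij_if_span_eq_span_bases[of C B] assms by auto
  with C(1) show ?thesis
    unfolding lepoll_def by (metis bij_betw_def image_mono inj_on_subset)
qed

text \<open>
  If all \<open>T - \<mu>\<close> were invertible, the resolvents applied to one vector would form an independent
  family indexed by the whole field, which is larger than a basis.
\<close>

lemma small_dimension_imp_spectrum_nonempty:
  fixes s :: "'k::alg_closed_field \<Rightarrow> 'v::ab_group_add \<Rightarrow> 'v" and x :: 'v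
  assumes "endomorphism s T"
    and B: "\<not> module.dependent s B" "module.span s B = UNIV" "B \<prec> (UNIV :: 'k set)"
    and "x \<noteq> 0"
  shows "\<exists>\<mu>. \<not> bij (\<lambda>v. T v - s \<mu> v)"
proof (rule ccontr)
  assume "\<nexists>\<mu>. \<not> bij (\<lambda>v. T v - s \<mu> v)"
  then have bij: "bij (\<lambda>v. T v - s \<mu> v)" for \<mu>
    by simp
  interpret endomorphism s T by fact
  have inj: "v = 0" if "T v = s \<mu> v" for \<mu> v
    using that injD[OF bij_is_inj[OF bij, of \<mu>], of v 0] by simp
  define y where "y \<mu> = inv_into UNIV (\<lambda>v. T v - s \<mu> v) x" for \<mu>
  have y: "T (y \<mu>) - s \<mu> (y \<mu>) = x" for \<mu>
    unfolding y_def by (rule surj_f_inv_f[OF bij_is_surj[OF bij]])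
  have indep: "independent (range y)" and inj_y: "inj y"
    using resolvents_independent[OF \<open>endomorphism s T\<close> _ y \<open>x \<noteq> 0\<close>] inj by blast+
  have "(UNIV :: 'k set) \<lesssim> range y"
    unfolding lepoll_def using inj_y by blast
  also have "range y \<lesssim> B"
    using indep B by (intro independent_lepoll_basis)
  finally show False
    using B(3) by (meson lesspoll_trans2 lesspoll_not_refl lesspoll_def lepoll_antisym)
qed

section \<open>Homogeneous components\<close>

locale total_graded_simple = graded_simple_lie_algebra scale UNIV br UNIV D
  for scale :: "'k::field \<Rightarrow> 'v::ab_group_add \<Rightarrow> 'v" (infixr \<open>*s\<close> 75)
    and br :: "'v \<Rightarrow> 'v \<Rightarrow> 'v"
    and D :: "'q::ab_group_add \<Rightarrow> 'v set"
begin

lemmas br_simps = br_add_left[simplified] br_add_right[simplified]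
  br_scale_left[simplified] br_scale_right[simplified]

lemma br_minus_right: "br x (- y) = - br x y"
  using br_scale_right[of x y "- 1"] by simp

lemma br_diff_right: "br x (y - z) = br x y - br x z"
  using br_add_right[of x y "- z"] by (simp add: br_minus_right)

lemmas D_subspace = subspace_component[simplified]
lemmas D_0 [simp] = subspace_0[OF D_subspace]
lemmas D_add = subspace_add[OF D_subspace]
lemmas D_scale = subspace_scale[OF D_subspace]
lemmas D_diff = subspace_diff[OF D_subspace]
lemmas D_br = br_component[simplified]

definition component :: "'q \<Rightarrow> 'v \<Rightarrow> 'v" where
  "component \<alpha> v =
    (THE f. finite {i. f i \<noteq> 0} \<and> (\<forall>i. f i \<in> D i) \<and> v = (\<Sum>i | f i \<noteq> 0. f i)) \<alpha>"

lemma ex1_component: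
  "\<exists>!f. finite {i. f i \<noteq> 0} \<and> (\<forall>i. f i \<in> D i) \<and> v = (\<Sum>i | f i \<noteq> 0. f i)"
  using direct_sum by (simp add: is_direct_sum_def)

lemma finite_support [simp]: "finite {\<alpha>. component \<alpha> v \<noteq> 0}"
  and component_in_D [simp]: "component \<alpha> v \<in> D \<alpha>"
  and sum_support: "v = (\<Sum>\<alpha> | component \<alpha> v \<noteq> 0. component \<alpha> v)"
  using theI'[OF ex1_component[of v]] by (simp_all add: component_def)

lemma sum_component:
  assumes "finite S" "{\<alpha>. component \<alpha> v \<noteq> 0} \<subseteq> S"
  shows "(\<Sum>\<alpha>\<in>S. component \<alpha> v) = v"
  using assms by (subst (3) sum_support) (intro sum.mono_neutral_right; auto)

lemma component_unique:
  assumes "finite S" "\<And>\<alpha>. \<alpha> \<in> S \<Longrightarrow> f \<alpha> \<in> D \<alpha>"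
  shows "component \<alpha> (sum f S) = (if \<alpha> \<in> S then f \<alpha> else 0)"
proof -
  define g where "g \<alpha> = (if \<alpha> \<in> S then f \<alpha> else 0)" for \<alpha>
  have "{i. g i \<noteq> 0} \<subseteq> S" "\<forall>i. g i \<in> D i"
    using assms by (auto simp: g_def)
  moreover have "sum f S = (\<Sum>i | g i \<noteq> 0. g i)"
    using assms by (intro sum.mono_neutral_cong_right) (auto simp: g_def)
  ultimately have "(THE f'. finite {i. f' i \<noteq> 0} \<and> (\<forall>i. f' i \<in> D i) \<and>
      sum f S = (\<Sum>i | f' i \<noteq> 0. f' i)) = g"
    using assms(1) by (intro the1_equality ex1_component) (auto intro: finite_subset)
  then show ?thesis
    by (simp add: component_def g_def)
qed

lemma component_of_homogeneous:
  "v \<in> D \<alpha> \<Longrightarrow> component \<beta> v = (if \<beta> = \<alpha> then v else 0)"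
  using component_unique[of "{\<alpha>}" "\<lambda>_. v" \<beta>] by auto

lemma component_0 [simp]: "component \<alpha> 0 = 0"
  using component_unique[of "{}"] by simp

lemma component_add: "component \<alpha> (v + w) = component \<alpha> v + component \<alpha> w"
proof -
  let ?S = "{\<alpha>. component \<alpha> v \<noteq> 0} \<union> {\<alpha>. component \<alpha> w \<noteq> 0}"
  have "v + w = (\<Sum>\<alpha>\<in>?S. component \<alpha> v + component \<alpha> w)"
    by (simp add: sum.distrib sum_component)
  then have "component \<alpha> (v + w) = (if \<alpha> \<in> ?S then component \<alpha> v + component \<alpha> w else 0)"
    by (simp only:) (rule component_unique; simp add: D_add)
  then show ?thesis
    by auto
qed

lemma component_scale: "component \<alpha> (c *s v) = c *s component \<alpha> v"
proof -
  let ?S = "{\<alpha>. component \<alpha> v \<noteq> 0}"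
  have "c *s v = (\<Sum>\<alpha>\<in>?S. c *s component \<alpha> v)"
    by (simp add: sum_component flip: scale_sum_right)
  then have "component \<alpha> (c *s v) = (if \<alpha> \<in> ?S then c *s component \<alpha> v else 0)"
    by (simp only:) (rule component_unique; simp add: D_scale)
  then show ?thesis
    by auto
qed

lemma component_sum: "component \<alpha> (sum f S) = (\<Sum>i\<in>S. component \<alpha> (f i))"
  by (induction S rule: infinite_finite_induct) (simp_all add: component_add)

lemma component_eqI: "(\<And>\<alpha>. component \<alpha> v = component \<alpha> w) \<Longrightarrow> v = w"
  by (subst sum_support, subst (3) sum_support) simp

lemma homogeneous_induct:
  assumes "\<And>\<alpha> v. v \<in> D \<alpha> \<Longrightarrow> P v" "\<And>v w. P v \<Longrightarrow> P w \<Longrightarrow> P (v + w)"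
  shows "P v"
proof -
  have "P (\<Sum>\<alpha>\<in>S. component \<alpha> v)" if "finite S" for S
    using that
  proof (induction S)
    case empty
    show ?case using assms(1)[of 0] by simp
  next
    case (insert \<alpha> S)
    then show ?case using assms(2) assms(1)[OF component_in_D] by simp
  qed
  from this[OF finite_support[of v]] show ?thesis
    using sum_support[of v] by simp
qed

lemma component_br: "z \<in> D \<alpha> \<Longrightarrow> component \<beta> (br z v) = br z (component (\<beta> - \<alpha>) v)"
proof (induction v rule: homogeneous_induct)
  case (1 \<gamma> v)
  then show ?case
    using D_br[of z \<alpha> v \<gamma>] by (auto simp: component_of_homogeneous algebra_simps)
qed (simp add: component_add br_simps)

text \<open>Additive maps are built from their restrictions \<open>h \<alpha>\<close> to the components.\<close>

definition glue :: "('q \<Rightarrow> 'v \<Rightarrow> 'w::ab_group_add) \<Rightarrow> 'v \<Rightarrow> 'w" where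
  "glue h v = (\<Sum>\<alpha> | component \<alpha> v \<noteq> 0. h \<alpha> (component \<alpha> v))"

context
  fixes h :: "'q \<Rightarrow> 'v \<Rightarrow> 'w::ab_group_add"
  assumes h_add: "\<And>\<alpha> v w. v \<in> D \<alpha> \<Longrightarrow> w \<in> D \<alpha> \<Longrightarrow> h \<alpha> (v + w) = h \<alpha> v + h \<alpha> w"
begin

lemma h_0: "h \<alpha> 0 = 0"
  using h_add[of 0 \<alpha> 0] by simp

lemma glue_superset:
  "finite S \<Longrightarrow> {\<alpha>. component \<alpha> v \<noteq> 0} \<subseteq> S \<Longrightarrow> glue h v = (\<Sum>\<alpha>\<in>S. h \<alpha> (component \<alpha> v))"
  unfolding glue_def by (rule sum.mono_neutral_left) (auto simp: h_0)

lemma glue_homogeneous: "v \<in> D \<alpha> \<Longrightarrow> glue h v = h \<alpha> v"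
  by (subst glue_superset[of "{\<alpha>}"]) (auto simp: component_of_homogeneous)

lemma glue_add: "glue h (v + w) = glue h v + glue h w"
proof -
  let ?S = "{\<alpha>. component \<alpha> v \<noteq> 0} \<union> {\<alpha>. component \<alpha> w \<noteq> 0}"
  have "{\<alpha>. component \<alpha> (v + w) \<noteq> 0} \<subseteq> ?S"
    by (auto simp: component_add)
  then show ?thesis
    by (simp add: glue_superset[of ?S] component_add h_add sum.distrib)
qed

end

lemma glue_scale:
  fixes h :: "'q \<Rightarrow> 'v \<Rightarrow> 'v"
  assumes "\<And>\<alpha> v w. v \<in> D \<alpha> \<Longrightarrow> w \<in> D \<alpha> \<Longrightarrow> h \<alpha> (v + w) = h \<alpha> v + h \<alpha> w"
    and "\<And>\<alpha> c v. v \<in> D \<alpha> \<Longrightarrow> h \<alpha> (c *s v) = c *s h \<alpha> v"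
  shows "glue h (c *s v) = c *s glue h v"
proof (induction v rule: homogeneous_induct)
  case (1 \<alpha> v)
  then show ?case
    using glue_homogeneous[of h v \<alpha>] glue_homogeneous[of h "c *s v" \<alpha>] assms
    by (simp add: D_scale)
next
  case (2 v w)
  then show ?case
    using glue_add[of h] assms(1) by (simp add: scale_right_distrib)
qed

text \<open>
  Graded simplicity in the form in which it is applied: a graded ideal is given by its components,
  and one nonzero homogeneous element forces it to be everything.
\<close>

lemma graded_subspace_trivial:
  assumes sub: "\<And>\<alpha>. subspace (N \<alpha>)" and ND: "\<And>\<alpha>. N \<alpha> \<subseteq> D \<alpha>"
    and br: "\<And>\<alpha> \<beta> z v. z \<in> D \<alpha> \<Longrightarrow> v \<in> N \<beta> \<Longrightarrow> br z v \<in> N (\<alpha> + \<beta>)"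
    and "v \<in> N \<alpha>" "v \<noteq> 0"
  shows "N \<beta> = D \<beta>"
proof -
  define J where "J = {v. \<forall>\<beta>. component \<beta> v \<in> N \<beta>}"
  have J_sub: "subspace J"
    using sub by (auto simp: subspace_def J_def component_add component_scale)
  have J_br: "br x y \<in> J" if "y \<in> J" for x y
  proof (induction x rule: homogeneous_induct)
    case (1 \<alpha> x)
    then show ?case
      using that br[of x \<alpha> _ "_ - \<alpha>"] by (simp add: J_def component_br)
  next
    case (2 v w)
    then show ?case by (simp add: br_simps subspace_add[OF J_sub])
  qed
  have NJ: "N \<beta> \<subseteq> J" for \<beta>
  proof
    fix v assume v: "v \<in> N \<beta>"
    with ND have "v \<in> D \<beta>" by blast
    with v show "v \<in> J"
      by (simp add: J_def component_of_homogeneous subspace_0[OF sub])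
  qed
  have "is_direct_sum UNIV (\<lambda>i. J \<inter> D i) J"
    unfolding is_direct_sum_def
  proof (intro conjI ballI)
    fix x assume x: "x \<in> J"
    then have c: "component \<alpha> x \<in> J" for \<alpha>
      using NJ by (auto simp: J_def)
    show "\<exists>!f. finite {i. f i \<noteq> 0} \<and> (\<forall>i\<in>UNIV. f i \<in> J \<inter> D i) \<and>
        (\<forall>i. i \<notin> UNIV \<longrightarrow> f i = 0) \<and> x = (\<Sum>i | f i \<noteq> 0. f i)"
    proof (rule ex1I[of _ "\<lambda>\<alpha>. component \<alpha> x"])
      show "finite {i. component i x \<noteq> 0} \<and> (\<forall>i\<in>UNIV. component i x \<in> J \<inter> D i) \<and>
        (\<forall>i. i \<notin> UNIV \<longrightarrow> component i x = 0) \<and> x = (\<Sum>i | component i x \<noteq> 0. component i x)"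
        using c sum_support[of x] by simp
      fix f assume f: "finite {i. f i \<noteq> 0} \<and> (\<forall>i\<in>UNIV. f i \<in> J \<inter> D i) \<and>
        (\<forall>i. i \<notin> UNIV \<longrightarrow> f i = 0) \<and> x = (\<Sum>i | f i \<noteq> 0. f i)"
      then have "component \<alpha> x = f \<alpha>" for \<alpha>
        using component_unique[of "{i. f i \<noteq> 0}" f \<alpha>] by auto
      then show "f = (\<lambda>\<alpha>. component \<alpha> x)" by auto
    qed
  qed simp
  with J_sub J_br have "graded_ideal J"
    by (simp add: graded_ideal_def lie_ideal_def)
  then have "J = {0} \<or> J = UNIV"
    by (rule graded_simple)
  with NJ[of \<alpha>] \<open>v \<in> N \<alpha>\<close> \<open>v \<noteq> 0\<close> have "J = UNIV"
    by blast
  have "D \<beta> \<subseteq> N \<beta>"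
  proof
    fix v assume "v \<in> D \<beta>"
    moreover have "component \<beta> v \<in> N \<beta>"
      using \<open>J = UNIV\<close> by (auto simp: J_def)
    ultimately show "v \<in> N \<beta>" by (simp add: component_of_homogeneous)
  qed
  with ND show ?thesis by blast
qed

lemma ex_homogeneous_br_nonzero:
  obtains \<alpha> \<beta> x y where "x \<in> D \<alpha>" "y \<in> D \<beta>" "br x y \<noteq> 0"
proof (rule ccontr)
  assume "\<not> thesis"
  with that have hom: "br x y = 0" if "x \<in> D \<alpha>" "y \<in> D \<beta>" for x y \<alpha> \<beta>
    using that by blast
  have "br x y = 0" if "x \<in> D \<alpha>" for x y \<alpha>
    by (induction y rule: homogeneous_induct) (use that hom in \<open>auto simp: br_simps\<close>)
  then have "br x y = 0" for x y
    by (induction x rule: homogeneous_induct) (auto simp: br_simps)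
  with not_commutative show False
    by (simp add: commutative_def)
qed

section \<open>The centroid\<close>

text \<open>The homogeneous elements of degree \<open>\<gamma>\<close> of the centroid.\<close>

definition centroidal :: "'q \<Rightarrow> ('v \<Rightarrow> 'v) \<Rightarrow> bool" where
  "centroidal \<gamma> c \<longleftrightarrow>
    (\<forall>v w. c (v + w) = c v + c w) \<and> (\<forall>a v. c (a *s v) = a *s c v) \<and>
    (\<forall>z v. c (br z v) = br z (c v)) \<and> (\<forall>\<alpha>. \<forall>v\<in>D \<alpha>. c v \<in> D (\<alpha> + \<gamma>))"

lemma centroidalD:
  assumes "centroidal \<gamma> c"
  shows "c (v + w) = c v + c w" "c (a *s v) = a *s c v" "c (br z v) = br z (c v)"
    "v \<in> D \<alpha> \<Longrightarrow> c v \<in> D (\<alpha> + \<gamma>)" "c 0 = 0" "c (- v) = - c v" "c (v - w) = c v - c w"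
proof -
  show add: "c (v + w) = c v + c w" and sc: "c (a *s v) = a *s c v" for v w a
    using assms by (simp_all add: centroidal_def)
  show m: "c (- v) = - c v" for v
    using sc[of "- 1" v] by simp
  show "c (v - w) = c v - c w"
    using add[of v "- w"] by (simp add: m)
  show "c 0 = 0"
    using sc[of 0 0] by simp
qed (use assms in \<open>auto simp: centroidal_def\<close>)

lemma centroidal_br_left: "centroidal \<gamma> c \<Longrightarrow> c (br v z) = br (c v) z"
  using br_anti[of z v] br_anti[of z "c v"] by (simp add: centroidalD)

lemma centroidal_scalar: "centroidal 0 (\<lambda>v. a *s v)"
  by (auto simp: centroidal_def br_simps D_scale scale_right_distrib mult.commute)

lemma centroidal_comp: "centroidal \<gamma> c \<Longrightarrow> centroidal \<delta> d \<Longrightarrow> centroidal (\<gamma> + \<delta>) (c \<circ> d)"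
  unfolding centroidal_def[of "\<gamma> + \<delta>"]
  by (auto simp: centroidalD) (metis centroidalD(4) add.assoc add.commute)

lemma centroidal_diff: "centroidal \<gamma> c \<Longrightarrow> centroidal \<gamma> d \<Longrightarrow> centroidal \<gamma> (\<lambda>v. c v - d v)"
  unfolding centroidal_def[of _ "\<lambda>v. c v - d v"]
  by (auto simp: centroidalD br_diff_right D_diff scale_right_diff_distrib)

lemma centroidal_component:
  "centroidal \<gamma> c \<Longrightarrow> component (\<alpha> + \<gamma>) (c v) = c (component \<alpha> v)"
  by (induction v rule: homogeneous_induct)
    (auto simp: centroidalD component_add component_of_homogeneous
      component_of_homogeneous[OF centroidalD(4)])

text \<open>
  The analogue of Schur's lemma. Kernel and image of a homogeneous centroid element are graded
  ideals, so a nonzero one is bijective.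
\<close>

lemma centroidal_inj:
  assumes c: "centroidal \<gamma> c" and "c w \<noteq> 0"
  shows "inj c"
proof -
  have zero: "v = 0" if "c v = 0" for v
  proof (rule ccontr)
    assume "v \<noteq> 0"
    define N where "N \<alpha> = {v \<in> D \<alpha>. c v = 0}" for \<alpha>
    obtain \<alpha> where \<alpha>: "component \<alpha> v \<noteq> 0"
      using component_eqI[of v 0] \<open>v \<noteq> 0\<close> by auto
    have "component \<alpha> v \<in> N \<alpha>"
      using centroidal_component[OF c, of \<alpha> v] \<open>c v = 0\<close> by (simp add: N_def)
    then have "N \<beta> = D \<beta>" for \<beta>
    proof (rule graded_subspace_trivial[rotated 3])
      show "subspace (N \<alpha>)" for \<alpha>
        using c by (auto simp: subspace_def N_def centroidalD D_add D_scale)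
      show "br z v \<in> N (\<alpha> + \<beta>)" if "z \<in> D \<alpha>" "v \<in> N \<beta>" for z v \<alpha> \<beta>
        using that c by (simp add: N_def D_br centroidalD)
    qed (auto simp: N_def \<alpha>)
    then have "c v = 0" if "v \<in> D \<beta>" for v \<beta>
      using that by (auto simp: N_def)
    then have "c w = 0"
      by (induction w rule: homogeneous_induct) (auto simp: centroidalD[OF c])
    with \<open>c w \<noteq> 0\<close> show False ..
  qed
  show ?thesis
    using zero[of "_ - _"] by (auto intro!: injI simp: centroidalD[OF c])
qed

lemma centroidal_surj:
  assumes c: "centroidal \<gamma> c" and "c w \<noteq> 0"
  shows "c ` D \<alpha> = D (\<alpha> + \<gamma>)"
proof -
  define N where "N \<beta> = c ` D (\<beta> - \<gamma>)" for \<beta>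
  obtain \<alpha>' where \<alpha>': "component \<alpha>' w \<noteq> 0"
    using component_eqI[of w 0] \<open>c w \<noteq> 0\<close> centroidalD(5)[OF c] by fastforce
  have "c (component \<alpha>' w) \<in> N (\<alpha>' + \<gamma>)"
    by (simp add: N_def)
  then have "N (\<alpha> + \<gamma>) = D (\<alpha> + \<gamma>)"
  proof (rule graded_subspace_trivial[rotated 3])
    show "c (component \<alpha>' w) \<noteq> 0"
      using centroidal_inj[OF assms] \<alpha>' centroidalD(5)[OF c] by (metis injD)
    show "N \<alpha> \<subseteq> D \<alpha>" for \<alpha>
      using centroidalD(4)[OF c, of _ "\<alpha> - \<gamma>"] by (auto simp: N_def)
    show "subspace (N \<alpha>)" for \<alpha>
    proof (rule subspaceI)
      show "0 \<in> N \<alpha>"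
        unfolding N_def using centroidalD(5)[OF c] by (intro image_eqI[of _ _ 0]) auto
    qed (auto simp: N_def D_add D_scale simp flip: centroidalD(1,2)[OF c])
    show "br z v \<in> N (\<alpha> + \<beta>)" if z: "z \<in> D \<alpha>" and "v \<in> N \<beta>" for z v \<alpha> \<beta>
    proof -
      obtain u where "u \<in> D (\<beta> - \<gamma>)" "v = c u"
        using \<open>v \<in> N \<beta>\<close> by (auto simp: N_def)
      then show ?thesis
        using D_br[OF z, of u "\<beta> - \<gamma>"] by (simp add: N_def add_diff_eq flip: centroidalD(3)[OF c])
    qed
  qed
  then show ?thesis
    by (simp add: N_def)
qed

lemma centroidal_bij:
  assumes c: "centroidal \<gamma> c" and "c w \<noteq> 0"
  shows "bij c"
proof (rule bijI[OF centroidal_inj[OF assms]])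
  have "v \<in> range c" for v
  proof (induction v rule: homogeneous_induct)
    case (1 \<alpha> v)
    then show ?case using centroidal_surj[OF assms, of "\<alpha> - \<gamma>"] by auto
  next
    case (2 v w)
    then show ?case by (auto simp flip: centroidalD(1)[OF c])
  qed
  then show "surj c" by auto
qed

lemma centroidal_inverse:
  assumes c: "centroidal \<gamma> c" and "c w \<noteq> 0"
  shows "centroidal (- \<gamma>) (inv_into UNIV c)"
proof -
  have i: "inv_into UNIV c (c v) = v" "c (inv_into UNIV c v) = v" for v
    using centroidal_bij[OF assms] by (simp_all add: bij_is_inj bij_is_surj surj_f_inv_f)
  have eq: "inv_into UNIV c v = u" if "v = c u" for u v
    using i that by simp
  have "inv_into UNIV c v \<in> D (\<alpha> - \<gamma>)" if "v \<in> D \<alpha>" for v \<alpha>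
  proof -
    have "v \<in> c ` D (\<alpha> - \<gamma>)"
      using that centroidal_surj[OF assms, of "\<alpha> - \<gamma>"] by simp
    then show ?thesis using i(1) by auto
  qed
  then show ?thesis
    unfolding centroidal_def by (auto intro!: eq simp: centroidalD[OF c] i)
qed

text \<open>
  On a bracket, one of the two maps can be applied to either argument, so the commutator kills all
  brackets. Some bracket is nonzero, and a nonzero centroid element would be injective.
\<close>

lemma centroidal_commute:
  assumes c: "centroidal \<gamma> c" and d: "centroidal \<delta> d"
  shows "c (d v) = d (c v)"
proof (rule ccontr)
  let ?e = "\<lambda>v. (c \<circ> d) v - (d \<circ> c) v"
  assume "c (d v) \<noteq> d (c v)"
  then have nz: "?e v \<noteq> 0" by simp
  have e: "centroidal (\<gamma> + \<delta>) ?e"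
    using centroidal_diff[OF centroidal_comp[OF c d], of "d \<circ> c"] centroidal_comp[OF d c]
    by (simp add: add.commute)
  obtain \<alpha> \<beta> x y where "br x y \<noteq> 0"
    using ex_homogeneous_br_nonzero by metis
  moreover have "c (d (br x y)) = br (c x) (d y)"
    by (simp only: centroidalD(3)[OF d] centroidal_br_left[OF c])
  moreover have "d (c (br x y)) = br (c x) (d y)"
    by (simp only: centroidalD(3)[OF d] centroidal_br_left[OF c])
  ultimately show False
    using injD[OF centroidal_inj[OF e nz], of "br x y" 0] centroidalD(5)[OF e] by auto
qed

section \<open>Splitting the units of the centroid\<close>

definition centroid_unit :: "'q \<Rightarrow> ('v \<Rightarrow> 'v) \<Rightarrow> bool" where
  "centroid_unit \<gamma> c \<longleftrightarrow> centroidal \<gamma> c \<and> (\<exists>w. c w \<noteq> 0)"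

lemma centroid_unitD:
  assumes "centroid_unit \<gamma> c"
  shows "centroidal \<gamma> c" "bij c" "c v = 0 \<longleftrightarrow> v = 0" "c ` D \<alpha> = D (\<alpha> + \<gamma>)"
proof -
  show c: "centroidal \<gamma> c" and b: "bij c" and "c ` D \<alpha> = D (\<alpha> + \<gamma>)"
    using assms centroidal_bij centroidal_surj by (metis centroid_unit_def)+
  show "c v = 0 \<longleftrightarrow> v = 0"
    using injD[OF bij_is_inj[OF b], of v 0] centroidalD(5)[OF c] by auto
qed

lemma ex_nonzero: "\<exists>v::'v. v \<noteq> 0"
  using ex_homogeneous_br_nonzero by metis

lemma centroid_unit_scalar: "a \<noteq> 0 \<Longrightarrow> centroid_unit 0 (scale a)"
  using ex_nonzero centroidal_scalar[of a] by (simp add: centroid_unit_def)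

lemma centroid_unit_comp: "centroid_unit \<gamma> c \<Longrightarrow> centroid_unit \<delta> d \<Longrightarrow> centroid_unit (\<gamma> + \<delta>) (c \<circ> d)"
  using centroid_unitD(1,3) centroidal_comp ex_nonzero by (simp add: centroid_unit_def[of "_ + _"])

lemma centroid_unit_inverse: "centroid_unit \<gamma> c \<Longrightarrow> centroid_unit (- \<gamma>) (inv_into UNIV c)"
  using centroidal_inverse centroid_unitD(2)[of \<gamma> c] unfolding centroid_unit_def
  by (metis bij_inv_eq_iff)

lemma centroid_unit_degree_unique:
  assumes c: "centroid_unit \<gamma> c" and d: "centroid_unit \<delta> c"
  shows "\<gamma> = \<delta>"
proof (rule ccontr)
  assume "\<gamma> \<noteq> \<delta>"
  obtain v :: 'v where "v \<noteq> 0" using ex_nonzero by blast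
  then obtain \<alpha> where \<alpha>: "component \<alpha> v \<noteq> 0"
    using component_eqI[of v 0] by auto
  let ?u = "c (component \<alpha> v)"
  have "?u \<in> D (\<alpha> + \<gamma>)" "?u \<in> D (\<alpha> + \<delta>)"
    using centroidalD(4)[OF centroid_unitD(1)[OF c]] centroidalD(4)[OF centroid_unitD(1)[OF d]]
    by simp_all
  then have "?u = 0"
    using \<open>\<gamma> \<noteq> \<delta>\<close> component_of_homogeneous[of ?u "\<alpha> + \<gamma>" "\<alpha> + \<gamma>"]
      component_of_homogeneous[of ?u "\<alpha> + \<delta>" "\<alpha> + \<gamma>"] by simp
  with \<alpha> centroid_unitD(3)[OF c] show False by simp
qed

definition centroid_degrees :: "'q set" where
  "centroid_degrees = {\<gamma>. \<exists>c. centroid_unit \<gamma> c}"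

lemma subgroup_centroid_degrees: "is_subgroup centroid_degrees"
  unfolding is_subgroup_def centroid_degrees_def
proof (intro conjI ballI)
  show "0 \<in> {\<gamma>. \<exists>c. centroid_unit \<gamma> c}"
    using centroid_unit_scalar[of 1] by auto
qed (simp; elim exE; rule exI, erule centroid_unit_comp centroid_unit_inverse; assumption?)+

text \<open>
  The nonzero homogeneous centroid elements form an abelian group under composition, and the degree
  maps it onto \<open>centroid_degrees\<close> with kernel the nonzero scalars. These are divisible when the
  field has all roots, so a complement of the kernel is the image of a multiplicative section.
\<close>

lemma centroid_splits:
  assumes scalar: "\<And>c. centroidal 0 c \<Longrightarrow> \<exists>a. c = scale a"
    and roots: "\<And>(a::'k) n. 0 < n \<Longrightarrow> \<exists>b. b ^ n = a"
  obtains sec where "\<And>\<gamma>. \<gamma> \<in> centroid_degrees \<Longrightarrow> centroid_unit \<gamma> (sec \<gamma>)"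
    "\<And>\<gamma> \<delta>. \<gamma> \<in> centroid_degrees \<Longrightarrow> \<delta> \<in> centroid_degrees \<Longrightarrow> sec (\<gamma> + \<delta>) = sec \<gamma> \<circ> sec \<delta>"
proof -
  define G where "G =
    \<lparr>carrier = {c. \<exists>\<gamma>. centroid_unit \<gamma> c}, monoid.mult = (\<circ>), one = (id :: 'v \<Rightarrow> 'v)\<rparr>"
  define K where "K = scale ` (- {0})"
  have id: "scale 1 = id" by auto
  have inv: "inv_into UNIV c \<circ> c = id" if "centroid_unit \<gamma> c" for c \<gamma>
    using centroid_unitD(2)[OF that] by (simp add: bij_is_inj)
  interpret G: comm_group G
  proof (rule comm_groupI)
    show "x \<otimes>\<^bsub>G\<^esub> y \<in> carrier G" if "x \<in> carrier G" "y \<in> carrier G" for x y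
      using that centroid_unit_comp unfolding G_def by (simp, blast)
    show "\<one>\<^bsub>G\<^esub> \<in> carrier G"
      using centroid_unit_scalar[of 1] by (auto simp: G_def id)
    show "x \<otimes>\<^bsub>G\<^esub> y = y \<otimes>\<^bsub>G\<^esub> x" if "x \<in> carrier G" "y \<in> carrier G" for x y
      using that centroidal_commute centroid_unitD(1) by (fastforce simp: G_def)
    show "\<exists>y\<in>carrier G. y \<otimes>\<^bsub>G\<^esub> x = \<one>\<^bsub>G\<^esub>" if "x \<in> carrier G" for x
      using that centroid_unit_inverse inv by (fastforce simp: G_def)
  qed (auto simp: G_def)
  have K_inv: "inv\<^bsub>G\<^esub> (scale a) = scale (inverse a)" if "a \<noteq> 0" for a
    using that centroid_unit_scalar[of a] centroid_unit_scalar[of "inverse a"]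
    by (intro G.inv_equality) (auto simp: G_def)
  have K: "subgroup K G"
  proof (rule G.subgroupI)
    show "K \<subseteq> carrier G"
      using centroid_unit_scalar by (auto simp: K_def G_def)
    show "K \<noteq> {}"
      unfolding K_def by (simp, metis ComplI empty_iff singletonD zero_neq_one)
    show "inv\<^bsub>G\<^esub> a \<in> K" if "a \<in> K" for a
      using that by (auto simp: K_def K_inv)
    show "a \<otimes>\<^bsub>G\<^esub> b \<in> K" if ab: "a \<in> K" "b \<in> K" for a b
    proof -
      obtain p q where pq: "a = scale p" "b = scale q" "p \<noteq> 0" "q \<noteq> 0"
        using ab by (auto simp: K_def)
      then have "a \<otimes>\<^bsub>G\<^esub> b = scale (p * q)" by (auto simp: G_def)
      with pq show ?thesis by (auto simp: K_def)
    qed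
  qed
  have pow: "scale a [^]\<^bsub>G\<^esub> (n::nat) = scale (a ^ n)" for a n
    by (induction n) (auto simp: G_def nat_pow_def id mult.commute fun_eq_iff)
  have div: "\<exists>l\<in>K. l [^]\<^bsub>G\<^esub> (n :: nat) = k" if k: "k \<in> K" and n: "0 < n" for k n
  proof -
    obtain a where a: "a \<noteq> 0" "k = scale a" using k by (auto simp: K_def)
    obtain b where b: "b ^ n = a" using roots[OF n] by blast
    with a n have "b \<noteq> 0" by auto
    with a b show ?thesis by (auto simp: K_def pow)
  qed
  obtain S where S: "subgroup S G" "S \<inter> K = {\<one>\<^bsub>G\<^esub>}"
    and SK: "\<And>z. z \<in> carrier G \<Longrightarrow> \<exists>s\<in>S. \<exists>k\<in>K. z = s \<otimes>\<^bsub>G\<^esub> k"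
    using G.divisible_subgroup_has_complement[OF K div] by blast
  have ex: "\<exists>c\<in>S. centroid_unit \<gamma> c" if \<gamma>: "\<gamma> \<in> centroid_degrees" for \<gamma>
  proof -
    obtain z where z: "centroid_unit \<gamma> z"
      using \<gamma> by (auto simp: centroid_degrees_def)
    then have "z \<in> carrier G" by (auto simp: G_def)
    then obtain s k where s: "s \<in> S" and k: "k \<in> K" and zsk: "z = s \<otimes>\<^bsub>G\<^esub> k"
      using SK by blast
    from s obtain \<delta> where \<delta>: "centroid_unit \<delta> s"
      using subgroup.mem_carrier[OF S(1)] by (auto simp: G_def)
    have "centroid_unit 0 k"
      using k centroid_unit_scalar by (auto simp: K_def)
    from centroid_unit_comp[OF \<delta> this] have "centroid_unit \<delta> z"
      by (simp add: zsk G_def)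
    with z have "\<delta> = \<gamma>" by (rule centroid_unit_degree_unique[symmetric])
    with s \<delta> show ?thesis by blast
  qed
  \<comment> \<open>Two elements of \<open>S\<close> of the same degree differ by a scalar in \<open>S\<close>, that is, by \<open>1\<close>.\<close>
  have uniq: "c = d"
    if c: "c \<in> S" "centroid_unit \<gamma> c" and d: "d \<in> S" "centroid_unit \<gamma> d" for c d \<gamma>
  proof -
    have cG: "c \<in> carrier G" and dG: "d \<in> carrier G"
      using c d by (auto simp: G_def)
    have inv_d: "inv\<^bsub>G\<^esub> d = inv_into UNIV d"
      using centroid_unit_inverse[OF d(2)] inv[OF d(2)] dG
        by (intro G.inv_equality) (auto simp: G_def)
    let ?e = "c \<otimes>\<^bsub>G\<^esub> inv\<^bsub>G\<^esub> d"
    have "centroid_unit 0 ?e"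
      using centroid_unit_comp[OF c(2) centroid_unit_inverse[OF d(2)]] unfolding inv_d
        by (simp add: G_def)
    then obtain a where a: "?e = scale a"
      using scalar centroid_unitD(1) by blast
    have "a \<noteq> 0"
      using \<open>centroid_unit 0 ?e\<close> by (auto simp: centroid_unit_def a)
    then have "?e \<in> K" by (auto simp: a K_def)
    moreover have "?e \<in> S"
      using S(1) c d subgroup.m_closed subgroup.m_inv_closed by metis
    ultimately have "?e = \<one>\<^bsub>G\<^esub>" using S(2) by blast
    then show ?thesis
      using cG dG G.inv_equality G.inv_inv G.inv_closed by metis
  qed
  define sec where "sec \<gamma> = (SOME c. c \<in> S \<and> centroid_unit \<gamma> c)" for \<gamma>
  have sec: "sec \<gamma> \<in> S" "centroid_unit \<gamma> (sec \<gamma>)" if "\<gamma> \<in> centroid_degrees" for \<gamma>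
    using someI_ex[of "\<lambda>c. c \<in> S \<and> centroid_unit \<gamma> c"] ex[OF that] by (auto simp: sec_def)
  have "sec (\<gamma> + \<delta>) = sec \<gamma> \<circ> sec \<delta>" if "\<gamma> \<in> centroid_degrees" "\<delta> \<in> centroid_degrees" for \<gamma> \<delta>
  proof (rule uniq)
    have "\<gamma> + \<delta> \<in> centroid_degrees"
      using that subgroup_centroid_degrees by (simp add: is_subgroup_def)
    then show "sec (\<gamma> + \<delta>) \<in> S" "centroid_unit (\<gamma> + \<delta>) (sec (\<gamma> + \<delta>))"
      by (simp_all add: sec)
    show "sec \<gamma> \<circ> sec \<delta> \<in> S"
      using subgroup.m_closed[OF S(1) sec(1) sec(1)] that by (simp add: G_def)
    show "centroid_unit (\<gamma> + \<delta>) (sec \<gamma> \<circ> sec \<delta>)"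
      using that by (intro centroid_unit_comp sec)
  qed
  with sec(2) that show thesis by blast
qed

section \<open>Multiplication operators\<close>

text \<open>
  The homogeneous elements of the unital associative algebra generated by the left multiplications.
  By graded simplicity they carry any nonzero homogeneous vector to every other one.
\<close>

inductive mult_op :: "'q \<Rightarrow> ('v \<Rightarrow> 'v) \<Rightarrow> bool" where
  mult_op_id: "mult_op 0 (\<lambda>v. v)"
| mult_op_br: "mult_op \<delta> u \<Longrightarrow> z \<in> D \<epsilon> \<Longrightarrow> mult_op (\<epsilon> + \<delta>) (\<lambda>v. br z (u v))"
| mult_op_add: "mult_op \<delta> u \<Longrightarrow> mult_op \<delta> u' \<Longrightarrow> mult_op \<delta> (\<lambda>v. u v + u' v)"
| mult_op_scale: "mult_op \<delta> u \<Longrightarrow> mult_op \<delta> (\<lambda>v. a *s u v)"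

lemma mult_op_zero: "mult_op \<delta> (\<lambda>v. 0)"
  using mult_op_br[OF mult_op_id, of 0 \<delta>] by simp

lemma mult_op_D: "mult_op \<delta> u \<Longrightarrow> v \<in> D \<alpha> \<Longrightarrow> u v \<in> D (\<alpha> + \<delta>)"
proof (induction rule: mult_op.induct)
  case (mult_op_br \<delta> u z \<epsilon>)
  then show ?case using D_br[of z \<epsilon> "u v" "\<alpha> + \<delta>"] by (simp add: ac_simps)
qed (simp_all add: D_add D_scale)

lemma mult_op_vec_add: "mult_op \<delta> u \<Longrightarrow> u (v + w) = u v + u w"
  by (induction rule: mult_op.induct) (simp_all add: br_simps scale_right_distrib)

lemma mult_op_vec_scale: "mult_op \<delta> u \<Longrightarrow> u (a *s v) = a *s u v"
  by (induction rule: mult_op.induct) (simp_all add: br_simps scale_right_distrib mult.commute)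

lemma mult_op_vec_0: "mult_op \<delta> u \<Longrightarrow> u 0 = 0"
  using mult_op_vec_scale[of \<delta> u 0 0] by simp

lemma mult_op_vec_sum: "mult_op \<delta> u \<Longrightarrow> u (sum f S) = (\<Sum>i\<in>S. u (f i))"
  by (induction S rule: infinite_finite_induct) (simp_all add: mult_op_vec_0 mult_op_vec_add)

lemma mult_op_ideal: "mult_op \<delta> u \<Longrightarrow> lie_ideal J \<Longrightarrow> v \<in> J \<Longrightarrow> u v \<in> J"
  by (induction rule: mult_op.induct)
    (auto simp: lie_ideal_def intro: subspace_add subspace_scale)

lemma mult_op_transitive:
  assumes x: "x \<in> D \<alpha>" "x \<noteq> 0" and "y \<in> D \<beta>"
  obtains u where "mult_op (\<beta> - \<alpha>) u" "u x = y"
proof -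
  define N where "N \<beta> = {u x |u. mult_op (\<beta> - \<alpha>) u}" for \<beta>
  have "x \<in> N \<alpha>"
    using mult_op_id by (auto simp: N_def)
  then have "N \<beta> = D \<beta>"
  proof (rule graded_subspace_trivial[rotated 3])
    show "x \<noteq> 0" by fact
    show "subspace (N \<beta>)" for \<beta>
    proof (rule subspaceI)
      show "0 \<in> N \<beta>" using mult_op_zero by (force simp: N_def)
    qed (auto simp: N_def intro: mult_op_add mult_op_scale)
    show "N \<beta> \<subseteq> D \<beta>" for \<beta>
      using mult_op_D[OF _ x(1), of "\<beta> - \<alpha>"] by (auto simp: N_def)
    show "br z v \<in> N (\<epsilon> + \<beta>)" if "z \<in> D \<epsilon>" "v \<in> N \<beta>" for \<epsilon> \<beta> z v
      using that mult_op_br[of "\<beta> - \<alpha>" _ z \<epsilon>] by (auto simp: N_def add_diff_eq)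
  qed
  with \<open>y \<in> D \<beta>\<close> have "y \<in> N \<beta>" by simp
  with that show thesis
    by (auto simp: N_def)
qed

text \<open>
  Since every homogeneous vector is \<open>u x\<close> for some multiplication operator \<open>u\<close>, the condition on
  annihilators makes \<open>u x \<mapsto> u y\<close> a well-defined map. It commutes with left multiplications by
  construction. This is the source of centroid elements of nonzero degree.
\<close>

lemma ex_centroidal_between:
  assumes x: "x \<in> D \<alpha>" "x \<noteq> 0" and y: "y \<in> D \<beta>"
    and ann: "\<And>\<delta> u. mult_op \<delta> u \<Longrightarrow> u x = 0 \<Longrightarrow> u y = 0"
  obtains c where "centroidal (\<beta> - \<alpha>) c" "c x = y"
proof -
  define h where "h \<gamma> v = (SOME u. mult_op (\<gamma> - \<alpha>) u \<and> u x = v) y" for \<gamma> v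
  have eq: "u y = u' y" if "mult_op \<delta> u" "mult_op \<delta> u'" "u x = u' x" for \<delta> u u'
    using ann[OF mult_op_add[OF that(1) mult_op_scale[OF that(2), of "- 1"]]] that(3) by simp
  have h: "h \<gamma> (u x) = u y" if u: "mult_op (\<gamma> - \<alpha>) u" for \<gamma> u
  proof -
    let ?u = "SOME u'. mult_op (\<gamma> - \<alpha>) u' \<and> u' x = u x"
    have "mult_op (\<gamma> - \<alpha>) ?u \<and> ?u x = u x"
      using someI[of "\<lambda>u'. mult_op (\<gamma> - \<alpha>) u' \<and> u' x = u x" u] u by simp
    with u show ?thesis
      unfolding h_def using eq by blast
  qed
  have ex: "\<exists>u. mult_op (\<gamma> - \<alpha>) u \<and> u x = v" if "v \<in> D \<gamma>" for \<gamma> v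
    using mult_op_transitive[OF x that] by blast
  have h_add: "h \<gamma> (v + w) = h \<gamma> v + h \<gamma> w" if "v \<in> D \<gamma>" "w \<in> D \<gamma>" for \<gamma> v w
    using ex[OF that(1)] ex[OF that(2)] h[OF mult_op_add] by (auto simp: h)
  have h_scale: "h \<gamma> (a *s v) = a *s h \<gamma> v" if "v \<in> D \<gamma>" for \<gamma> a v
    using ex[OF that(1)] h[OF mult_op_scale] by (auto simp: h)
  have h_br: "h (\<epsilon> + \<gamma>) (br z v) = br z (h \<gamma> v)" if "z \<in> D \<epsilon>" "v \<in> D \<gamma>" for \<epsilon> \<gamma> z v
    using ex[OF that(2)] h[of "\<epsilon> + \<gamma>" "\<lambda>v. br z (_ v)"] mult_op_br[OF _ that(1), of "\<gamma> - \<alpha>"]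
    by (auto simp: h add_diff_eq)
  have h_D: "h \<gamma> v \<in> D (\<gamma> + (\<beta> - \<alpha>))" if "v \<in> D \<gamma>" for \<gamma> v
    using ex[OF that] mult_op_D[OF _ y, of "\<gamma> - \<alpha>"] by (auto simp: h algebra_simps)
  let ?c = "glue h"
  have c_add: "?c (v + w) = ?c v + ?c w" for v w
    using h_add by (rule glue_add)
  have c_hom: "?c v = h \<gamma> v" if "v \<in> D \<gamma>" for v \<gamma>
    using h_add that by (rule glue_homogeneous)
  have "?c (br z v) = br z (?c v)" if "z \<in> D \<epsilon>" for z v \<epsilon>
  proof (induction v rule: homogeneous_induct)
    case (1 \<gamma> v)
    with that show ?case
      by (simp add: c_hom[of v \<gamma>] c_hom[OF D_br[OF that, of v \<gamma>]] h_br)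
  qed (simp add: br_simps c_add)
  then have "?c (br z v) = br z (?c v)" for z v
    by (induction z rule: homogeneous_induct) (simp_all add: br_simps c_add)
  then have "centroidal (\<beta> - \<alpha>) ?c"
    unfolding centroidal_def
    using c_add glue_scale[of h, OF h_add h_scale] by (auto simp: c_hom h_D)
  moreover have "?c x = y"
    using h[of \<alpha> "\<lambda>v. v"] mult_op_id by (simp add: c_hom[OF x(1)])
  ultimately show thesis by (rule that)
qed

end

section \<open>The centroid in degree zero\<close>

locale small_graded_simple = total_graded_simple scale br D
  for scale :: "'k::alg_closed_field \<Rightarrow> 'v::ab_group_add \<Rightarrow> 'v" (infixr \<open>*s\<close> 75)
    and br :: "'v \<Rightarrow> 'v \<Rightarrow> 'v"
    and D :: "'q::ab_group_add \<Rightarrow> 'v set" +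
  fixes B :: "'v set"
  assumes B: "independent B" "span B = UNIV" "B \<prec> (UNIV :: 'k set)"
begin

text \<open>
  Were \<open>c\<close> not a scalar, every \<open>c - \<mu>\<close> would be a nonzero element of the centroid, hence invertible,
  contradicting the bound on the dimension.
\<close>

lemma centroidal_0_scalar:
  assumes c: "centroidal 0 c"
  shows "\<exists>a. c = scale a"
proof (rule ccontr)
  assume "\<nexists>a. c = scale a"
  then have "\<exists>w. c w - \<mu> *s w \<noteq> 0" for \<mu>
    by (auto simp: fun_eq_iff)
  then have "bij (\<lambda>v. c v - \<mu> *s v)" for \<mu>
    using centroidal_bij[OF centroidal_diff[OF c centroidal_scalar]] by blast
  moreover have "endomorphism scale c"
    by unfold_locales (simp_all add: centroidalD[OF c])
  ultimately show False
    using small_dimension_imp_spectrum_nonempty[of scale c B] B ex_nonzero by blast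
qed

end

section \<open>The quotient by the split centroid\<close>

lemma coset_eq_iff:
  assumes "is_subgroup P"
  shows "\<alpha> +o P = \<beta> +o P \<longleftrightarrow> \<alpha> - \<beta> \<in> P"
proof
  assume "\<alpha> +o P = \<beta> +o P"
  moreover have "\<alpha> \<in> \<alpha> +o P"
    using assms set_plus_intro2[of 0 P \<alpha>] by (simp add: is_subgroup_def)
  ultimately show "\<alpha> - \<beta> \<in> P"
    by (simp add: set_plus_imp_minus)
next
  assume *: "\<alpha> - \<beta> \<in> P"
  then have "- (\<alpha> - \<beta>) \<in> P"
    using assms unfolding is_subgroup_def by blast
  have sub: "a +o P \<subseteq> b +o P" if "a - b \<in> P" for a b
  proof
    fix x assume "x \<in> a +o P"
    then have "x - a \<in> P" by (rule set_plus_imp_minus)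
    then have "(x - a) + (a - b) \<in> P"
      using that assms unfolding is_subgroup_def by blast
    then show "x \<in> b +o P"
      by (intro set_minus_imp_plus) simp
  qed
  from sub[of \<alpha> \<beta>] sub[of \<beta> \<alpha>] * \<open>- (\<alpha> - \<beta>) \<in> P\<close> show "\<alpha> +o P = \<beta> +o P"
    by simp
qed

text \<open>
  \<open>sec\<close> is a multiplicative section of the degree map on the units of the centroid. The components
  \<open>D \<alpha>\<close> and \<open>D (\<alpha> + \<gamma>)\<close> with \<open>\<gamma> \<in> centroid_degrees\<close> are identified by \<open>sec \<gamma>\<close>; the simple Lie
  algebra sought is the quotient of the graded one by all these identifications.
\<close>

locale split_centroid = total_graded_simple scale br D
  for scale :: "'k::field \<Rightarrow> 'v::ab_group_add \<Rightarrow> 'v" (infixr \<open>*s\<close> 75)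
    and br :: "'v \<Rightarrow> 'v \<Rightarrow> 'v"
    and D :: "'q::ab_group_add \<Rightarrow> 'v set" +
  fixes sec :: "'q \<Rightarrow> 'v \<Rightarrow> 'v"
  assumes sec_unit: "\<gamma> \<in> centroid_degrees \<Longrightarrow> centroid_unit \<gamma> (sec \<gamma>)"
    and sec_add: "\<gamma> \<in> centroid_degrees \<Longrightarrow> \<delta> \<in> centroid_degrees \<Longrightarrow> sec (\<gamma> + \<delta>) = sec \<gamma> \<circ> sec \<delta>"
begin

abbreviation P :: "'q set" where "P \<equiv> centroid_degrees"

lemma P_closed: "0 \<in> P" "\<alpha> \<in> P \<Longrightarrow> \<beta> \<in> P \<Longrightarrow> \<alpha> + \<beta> \<in> P" "\<alpha> \<in> P \<Longrightarrow> - \<alpha> \<in> P"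
  using subgroup_centroid_degrees by (simp_all add: is_subgroup_def)

lemma sec_0: "sec 0 v = v"
proof -
  have "sec 0 (sec 0 v) = sec 0 v"
    using sec_add[of 0 0] P_closed(1) by (simp add: fun_eq_iff)
  then show ?thesis
    using centroid_unitD(2)[OF sec_unit[OF P_closed(1)]] by (metis bij_is_inj injD)
qed

definition coset_rep :: "'q set \<Rightarrow> 'q" where
  "coset_rep X = (SOME \<alpha>. \<alpha> \<in> X)"

definition rep :: "'q \<Rightarrow> 'q" where
  "rep \<alpha> = coset_rep (\<alpha> +o P)"

lemma rep_diff: "rep \<alpha> - \<alpha> \<in> P"
proof -
  have "\<alpha> \<in> \<alpha> +o P"
    using set_plus_intro2[OF P_closed(1), of \<alpha>] by simp
  then have "rep \<alpha> \<in> \<alpha> +o P"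
    unfolding rep_def coset_rep_def by (rule someI)
  then show ?thesis by (rule set_plus_imp_minus)
qed

lemma rep_eq_iff: "rep \<alpha> = rep \<beta> \<longleftrightarrow> \<alpha> - \<beta> \<in> P"
proof
  assume "rep \<alpha> = rep \<beta>"
  then have "\<alpha> - \<beta> = - (rep \<alpha> - \<alpha>) + (rep \<beta> - \<beta>)" by simp
  then show "\<alpha> - \<beta> \<in> P"
    using P_closed(2)[OF P_closed(3)[OF rep_diff] rep_diff] by metis
next
  assume "\<alpha> - \<beta> \<in> P"
  then show "rep \<alpha> = rep \<beta>"
    unfolding rep_def coset_eq_iff[OF subgroup_centroid_degrees, symmetric] by simp
qed

lemma rep_rep [simp]: "rep (rep \<alpha>) = rep \<alpha>"
  by (simp add: rep_eq_iff rep_diff)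

lemma coset_rep_coset: "coset_rep (\<alpha> +o P) = rep \<alpha>"
  by (simp add: rep_def)

text \<open>
  The quotient by the ideal spanned by all \<open>sec \<gamma> v - v\<close> is realized on the sum of the components
  whose degrees are the chosen coset representatives: \<open>proj\<close> moves each homogeneous vector to the
  representative of its degree, and the ideal is its kernel.
\<close>

definition proj :: "'v \<Rightarrow> 'v" where
  "proj = glue (\<lambda>\<alpha>. sec (rep \<alpha> - \<alpha>))"

lemmas sec_centroidal = centroid_unitD(1)[OF sec_unit]

lemma proj_add: "proj (v + w) = proj v + proj w"
  unfolding proj_def by (rule glue_add) (simp add: centroidalD[OF sec_centroidal] rep_diff)

lemma proj_scale: "proj (a *s v) = a *s proj v"
  unfolding proj_def by (rule glue_scale) (simp_all add: centroidalD[OF sec_centroidal] rep_diff)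

lemma proj_hom: "v \<in> D \<alpha> \<Longrightarrow> proj v = sec (rep \<alpha> - \<alpha>) v"
  unfolding proj_def
    by (rule glue_homogeneous) (simp_all add: centroidalD[OF sec_centroidal] rep_diff)

lemma proj_0 [simp]: "proj 0 = 0"
  using proj_add[of 0 0] by simp

lemma proj_diff: "proj (v - w) = proj v - proj w"
  using proj_add[of "v - w" w] by simp

lemma proj_sum: "proj (sum f S) = (\<Sum>i\<in>S. proj (f i))"
  by (induction S rule: infinite_finite_induct) (simp_all add: proj_add)

lemma proj_D: "v \<in> D \<alpha> \<Longrightarrow> proj v \<in> D (rep \<alpha>)"
  using centroidalD(4)[OF sec_centroidal[OF rep_diff], of v \<alpha> \<alpha>] by (simp add: proj_hom)

lemma proj_hom_eq_0: "v \<in> D \<alpha> \<Longrightarrow> proj v = 0 \<longleftrightarrow> v = 0"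
  by (simp add: proj_hom centroid_unitD(3)[OF sec_unit] rep_diff)

lemma proj_image_D: "proj ` D \<alpha> = D (rep \<alpha>)"
proof -
  have "proj ` D \<alpha> = sec (rep \<alpha> - \<alpha>) ` D \<alpha>"
    by (rule image_cong) (simp_all add: proj_hom)
  then show ?thesis
    using centroid_unitD(4)[OF sec_unit[OF rep_diff], of \<alpha> \<alpha>] by simp
qed

lemma proj_rep: "v \<in> D (rep \<alpha>) \<Longrightarrow> proj v = v"
  using proj_hom[of v "rep \<alpha>"] by (simp add: sec_0)

lemma proj_proj [simp]: "proj (proj v) = proj v"
  by (induction v rule: homogeneous_induct) (simp_all add: proj_add proj_rep[OF proj_D])

lemma proj_sec:
  assumes "\<gamma> \<in> P"
  shows "proj (sec \<gamma> v) = proj v"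
proof (induction v rule: homogeneous_induct)
  case (1 \<alpha> v)
  have r: "rep (\<alpha> + \<gamma>) = rep \<alpha>"
    using assms by (simp add: rep_eq_iff)
  have "rep \<alpha> - (\<alpha> + \<gamma>) \<in> P"
    using rep_diff[of "\<alpha> + \<gamma>"] by (simp add: r)
  then have "sec (rep \<alpha> - \<alpha>) = sec (rep \<alpha> - (\<alpha> + \<gamma>)) \<circ> sec \<gamma>"
    using sec_add[of "rep \<alpha> - (\<alpha> + \<gamma>)" \<gamma>] assms by simp
  then show ?case
    using proj_hom[OF centroidalD(4)[OF sec_centroidal[OF assms] 1]] proj_hom[OF 1] by (simp add: r)
next
  case (2 v w)
  then show ?case by (simp add: proj_add centroidalD(1)[OF sec_centroidal[OF assms]])
qed

text \<open>
  The kernel of \<open>proj\<close> is an ideal, so the bracket descends to the image of \<open>proj\<close>.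
\<close>

lemma proj_br_proj: "proj (br x (proj y)) = proj (br x y)"
proof (induction y rule: homogeneous_induct)
  case (1 \<alpha> y)
  then show ?case
    by (simp add: proj_hom[of y] proj_sec rep_diff flip: centroidalD(3)[OF sec_centroidal])
qed (simp add: proj_add br_simps)

lemma proj_br_proj_left: "proj (br (proj x) y) = proj (br x y)"
proof (induction x rule: homogeneous_induct)
  case (1 \<alpha> x)
  then show ?case
    by (simp add: proj_hom[of x] proj_sec rep_diff flip: centroidal_br_left[OF sec_centroidal])
qed (simp add: proj_add br_simps)

lemma component_proj: "component \<beta> (proj v) \<noteq> 0 \<Longrightarrow> rep \<beta> = \<beta>"
proof (induction v rule: homogeneous_induct)
  case (1 \<alpha> v)
  then show ?case
    using component_of_homogeneous[OF proj_D, of v \<alpha> \<beta>] by (auto split: if_splits)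
next
  case (2 v w)
  then show ?case by (cases "component \<beta> (proj v) = 0") (simp_all add: proj_add component_add)
qed

definition A :: "'v set" where "A = {v. proj v = v}"

definition br' :: "'v \<Rightarrow> 'v \<Rightarrow> 'v" where "br' x y = proj (br x y)"

definition E :: "'q set \<Rightarrow> 'v set" where "E X = D (coset_rep X)"

lemma proj_A [simp]: "proj v \<in> A"
  by (simp add: A_def)

lemma A_subspace: "subspace A"
  by (auto simp: subspace_def A_def proj_add proj_scale)

lemma A_lie_algebra: "lie_algebra scale A br'"
proof
  show "br' x (br' y z) + br' y (br' z x) + br' z (br' x y) = 0" for x y z
    using jacobi[of x y z] by (simp add: br'_def proj_br_proj flip: proj_add)
qed (use A_subspace in \<open>simp_all add: br'_def br_simps proj_add proj_scale br_self\<close>)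

lemma E_coset: "E (\<alpha> +o P) = D (rep \<alpha>)"
  by (simp add: E_def coset_rep_coset)

text \<open>
  Indexing the components by cosets amounts to reindexing the decomposition of a vector along
  \<open>coset_rep\<close>, because the nonzero components of a vector in \<open>A\<close> sit in representative degrees.
\<close>

lemma A_direct_sum: "is_direct_sum (quotient_group P) E A"
  unfolding is_direct_sum_def
proof (intro conjI ballI)
  let ?Q = "quotient_group P"
  have coset: "coset_rep X +o P = X" if "X \<in> ?Q" for X
  proof -
    obtain \<alpha> where "X = \<alpha> +o P"
      using \<open>X \<in> ?Q\<close> by (auto simp: quotient_group_def)
    then show ?thesis
      by (simp only: coset_rep_coset coset_eq_iff[OF subgroup_centroid_degrees] rep_diff)
  qed
  then have inj: "inj_on coset_rep ?Q"
    by (metis inj_onI)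
  show "E X \<subseteq> A" if "X \<in> ?Q" for X
    using that by (auto simp: quotient_group_def E_coset A_def proj_rep)
  fix x assume "x \<in> A"
  then have supp: "rep \<beta> = \<beta>" if "component \<beta> x \<noteq> 0" for \<beta>
    using component_proj[of \<beta> x] that by (simp add: A_def)
  let ?f = "\<lambda>X. if X \<in> ?Q then component (coset_rep X) x else 0"
  let ?F = "{X. ?f X \<noteq> 0}"
  show "\<exists>!f. finite {i. f i \<noteq> 0} \<and> (\<forall>i\<in>?Q. f i \<in> E i) \<and> (\<forall>i. i \<notin> ?Q \<longrightarrow> f i = 0) \<and>
      x = (\<Sum>i | f i \<noteq> 0. f i)"
  proof (rule ex1I)
    have FQ: "?F \<subseteq> ?Q" by auto
    have img: "coset_rep ` ?F = {\<beta>. component \<beta> x \<noteq> 0}"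
    proof (intro equalityI subsetI)
      fix \<beta> assume "\<beta> \<in> {\<beta>. component \<beta> x \<noteq> 0}"
      then have \<beta>: "coset_rep (\<beta> +o P) = \<beta>" "component \<beta> x \<noteq> 0"
        using supp by (auto simp: coset_rep_coset)
      moreover have "\<beta> +o P \<in> ?Q"
        by (simp add: quotient_group_def)
      ultimately have "\<beta> +o P \<in> ?F" by simp
      from imageI[OF this, of coset_rep] show "\<beta> \<in> coset_rep ` ?F"
        unfolding \<beta>(1) .
    qed (auto split: if_splits)
    have "finite ?F"
      by (rule finite_imageD[OF _ inj_on_subset[OF inj FQ]]) (simp only: img finite_support)
    moreover have "(\<Sum>X\<in>?F. ?f X) = (\<Sum>X\<in>?F. component (coset_rep X) x)"
      by (intro sum.cong) auto
    moreover have "\<dots> = (\<Sum>\<beta>\<in>coset_rep ` ?F. component \<beta> x)"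
      using sum.reindex[OF inj_on_subset[OF inj FQ], of "\<lambda>\<beta>. component \<beta> x"]
        by (simp only: comp_def)
    ultimately show "finite ?F \<and> (\<forall>i\<in>?Q. ?f i \<in> E i) \<and> (\<forall>i. i \<notin> ?Q \<longrightarrow> ?f i = 0) \<and> x = (\<Sum>i\<in>?F. ?f i)"
      unfolding img using sum_support[of x] by (simp add: E_def)
  next
    fix f assume "finite {i. f i \<noteq> 0} \<and> (\<forall>i\<in>?Q. f i \<in> E i) \<and> (\<forall>i. i \<notin> ?Q \<longrightarrow> f i = 0) \<and>
      x = (\<Sum>i | f i \<noteq> 0. f i)"
    then have fin: "finite {i. f i \<noteq> 0}" and fE: "\<And>X. X \<in> ?Q \<Longrightarrow> f X \<in> E X"
      and f0: "\<And>X. X \<notin> ?Q \<Longrightarrow> f X = 0" and x: "x = (\<Sum>i | f i \<noteq> 0. f i)"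
      by auto
    let ?S = "{X. f X \<noteq> 0}"
    have SQ: "?S \<subseteq> ?Q" using f0 by auto
    let ?g = "\<lambda>\<beta>. f (\<beta> +o P)"
    have "x = (\<Sum>X\<in>?S. ?g (coset_rep X))"
      unfolding x using SQ by (intro sum.cong) (auto simp: coset subset_iff)
    also have "\<dots> = (\<Sum>\<beta>\<in>coset_rep ` ?S. ?g \<beta>)"
      using sum.reindex[OF inj_on_subset[OF inj SQ], of ?g] by (simp add: comp_def)
    finally have x': "x = (\<Sum>\<beta>\<in>coset_rep ` ?S. ?g \<beta>)" .
    have comp: "component \<beta> x = (if \<beta> \<in> coset_rep ` ?S then ?g \<beta> else 0)" for \<beta>
      unfolding x'
    proof (rule component_unique)
      show "finite (coset_rep ` ?S)" using fin by simp
      fix \<beta> assume "\<beta> \<in> coset_rep ` ?S"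
      then obtain X where X: "X \<in> ?S" "\<beta> = coset_rep X" by blast
      with SQ have "X \<in> ?Q" by blast
      with X fE[of X] show "?g \<beta> \<in> D \<beta>" by (simp add: coset E_def)
    qed
    show "f = ?f"
    proof
      fix X
      show "f X = ?f X"
      proof (cases "X \<in> ?Q")
        case True
        then have "coset_rep X \<in> coset_rep ` ?S \<longleftrightarrow> X \<in> ?S"
          using inj SQ by (meson inj_on_image_mem_iff)
        with True comp[of "coset_rep X"] show ?thesis by (simp add: coset)
      qed (simp add: f0)
    qed
  qed
qed

lemma A_graded: "graded_lie_algebra scale A br' (quotient_group P) E"
proof -
  interpret A: lie_algebra scale A br' by (rule A_lie_algebra)
  show ?thesis
  proof
    show "subspace (E X)" for X
      by (simp add: E_def D_subspace)
    show "is_direct_sum (quotient_group P) E A" by (rule A_direct_sum)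
    fix X Y x y assume "X \<in> quotient_group P" "Y \<in> quotient_group P" and xy: "x \<in> E X" "y \<in> E Y"
    then obtain \<alpha> \<beta> where XY: "X = \<alpha> +o P" "Y = \<beta> +o P"
      by (auto simp: quotient_group_def)
    with xy have "br x y \<in> D (rep \<alpha> + rep \<beta>)"
      by (simp add: E_coset D_br)
    moreover have "rep (rep \<alpha> + rep \<beta>) = rep (\<alpha> + \<beta>)"
      using P_closed(2)[OF rep_diff[of \<alpha>] rep_diff[of \<beta>]] by (simp add: rep_eq_iff algebra_simps)
    ultimately show "br' x y \<in> E (X + Y)"
      using proj_D[of "br x y" "rep \<alpha> + rep \<beta>"]
      by (simp add: XY coset_add[OF subgroup_centroid_degrees] E_coset br'_def)
  qed
qed

section \<open>Simplicity of the quotient\<close>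

text \<open>
  Let \<open>x\<close> be a nonzero element of the ideal with the fewest homogeneous components. A multiplication
  operator that kills one component of \<open>x\<close> produces, after applying \<open>proj\<close>, an element of the ideal
  with fewer components, hence \<open>0\<close>; it therefore kills all components. Two components of degrees \<open>\<alpha>\<close> and \<open>\<beta>\<close> thus give a centroid element of degree
  \<open>\<beta> - \<alpha>\<close>, so that \<open>\<alpha>\<close> and \<open>\<beta>\<close> represent the same coset and are equal. Therefore \<open>x\<close> is homogeneous,
  and multiplication operators carry it to every homogeneous vector.
\<close>

lemma A_simple_ideal:
  assumes J: "lie_algebra.lie_ideal scale A br' J" and "v \<in> J" "v \<noteq> 0"
  shows "J = A"
proof -
  interpret A: lie_algebra scale A br' by (rule A_lie_algebra)
  have J_sub: "subspace J" and JA: "J \<subseteq> A" and J_br: "\<And>x y. x \<in> A \<Longrightarrow> y \<in> J \<Longrightarrow> br' x y \<in> J"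
    using J by (auto simp: A.lie_ideal_def)
  \<comment> \<open>The multiplication operators of the graded algebra act on the preimage of \<open>J\<close>.\<close>
  define I where "I = {v. proj v \<in> J}"
  have I: "lie_ideal I"
    unfolding lie_ideal_def
  proof (intro conjI ballI)
    show "subspace I"
      using J_sub by (auto simp: subspace_def I_def proj_add proj_scale)
    show "br x y \<in> I" if "y \<in> I" for x y
    proof -
      have "br' (proj x) (proj y) \<in> J"
        using that by (intro J_br) (simp_all add: I_def)
      then show ?thesis by (simp add: I_def br'_def proj_br_proj proj_br_proj_left)
    qed
  qed simp
  define len where "len v = card {\<alpha>. component \<alpha> v \<noteq> 0}" for v
  obtain x where x: "x \<in> J" "x \<noteq> 0" and min: "\<And>w. w \<in> J \<Longrightarrow> w \<noteq> 0 \<Longrightarrow> len x \<le> len w"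
    using ex_has_least_nat[of "\<lambda>v. v \<in> J \<and> v \<noteq> 0" v len] assms(2,3) by auto
  have px: "proj x = x" using x JA by (auto simp: A_def)
  then have xI: "x \<in> I" using x by (simp add: I_def)
  have supp: "rep \<alpha> = \<alpha>" if "component \<alpha> x \<noteq> 0" for \<alpha>
    using component_proj[of \<alpha> x] that by (simp add: px)
  obtain \<alpha> where \<alpha>: "component \<alpha> x \<noteq> 0"
    using component_eqI[of x 0] x(2) by auto
  have only: "\<beta> = \<alpha>" if \<beta>: "component \<beta> x \<noteq> 0" for \<beta>
  proof -
    have "u (component \<beta> x) = 0" if u: "mult_op \<delta> u" and u0: "u (component \<alpha> x) = 0" for \<delta> u
    proof -
      let ?S = "{\<gamma>. component \<gamma> x \<noteq> 0}"
      let ?r = "\<lambda>\<gamma>. rep (\<gamma> + \<delta>)"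
      define w where "w = proj (u x)"
      have "w \<in> J"
        using mult_op_ideal[OF u I xI] by (simp add: I_def w_def)
      \<comment> \<open>Distinct components of \<open>x\<close> lie in distinct cosets, so their images under \<open>u\<close> cannot mix.\<close>
      have inj: "inj_on ?r ?S"
      proof (rule inj_onI)
        fix a b assume ab: "a \<in> ?S" "b \<in> ?S" "?r a = ?r b"
        then have "rep a = rep b" by (simp add: rep_eq_iff)
        with ab supp show "a = b" by simp
      qed
      have pu: "proj (u (component \<gamma> x)) \<in> D (?r \<gamma>)" for \<gamma>
        by (intro proj_D mult_op_D[OF u]) simp
      have "w = (\<Sum>\<gamma>\<in>?S. proj (u (component \<gamma> x)))"
        unfolding w_def by (subst sum_support) (simp only: mult_op_vec_sum[OF u] proj_sum)
      then have comp_w: "component \<epsilon> w =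
          (\<Sum>\<gamma>\<in>?S. if \<epsilon> = ?r \<gamma> then proj (u (component \<gamma> x)) else 0)" for \<epsilon>
        by (simp add: component_sum component_of_homogeneous[OF pu])
      have "{\<epsilon>. component \<epsilon> w \<noteq> 0} \<subseteq> ?r ` (?S - {\<alpha>})"
      proof
        fix \<epsilon> assume "\<epsilon> \<in> {\<epsilon>. component \<epsilon> w \<noteq> 0}"
        then obtain \<gamma> where \<gamma>: "\<gamma> \<in> ?S" "(if \<epsilon> = ?r \<gamma> then proj (u (component \<gamma> x)) else 0) \<noteq> 0"
          unfolding comp_w by (auto elim!: sum.not_neutral_contains_not_neutral)
        then have "\<epsilon> = ?r \<gamma>" "\<gamma> \<noteq> \<alpha>"
          using u0 by (auto split: if_splits)
        with \<gamma>(1) show "\<epsilon> \<in> ?r ` (?S - {\<alpha>})" by blast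
      qed
      then have "len w \<le> card (?r ` (?S - {\<alpha>}))"
        unfolding len_def by (intro card_mono) simp_all
      also have "\<dots> \<le> card (?S - {\<alpha>})"
        by (intro card_image_le) simp
      also have "\<dots> < len x"
        unfolding len_def using \<alpha> by (intro psubset_card_mono) auto
      finally have "w = 0"
        using min[OF \<open>w \<in> J\<close>] by (meson not_le)
      have "component (?r \<beta>) w = (\<Sum>\<gamma>\<in>?S. if \<gamma> = \<beta> then proj (u (component \<gamma> x)) else 0)"
        unfolding comp_w using inj \<beta> by (intro sum.cong) (auto simp: inj_on_def)
      also have "\<dots> = proj (u (component \<beta> x))"
        using \<beta> by simp
      finally have "proj (u (component \<beta> x)) = 0"
        using \<open>w = 0\<close> by simp
      then show ?thesis
        using proj_hom_eq_0[OF mult_op_D[OF u component_in_D]] by simp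
    qed
    then obtain c where c: "centroidal (\<beta> - \<alpha>) c" "c (component \<alpha> x) = component \<beta> x"
      using ex_centroidal_between[OF component_in_D \<alpha> component_in_D] by blast
    then have "c (component \<alpha> x) \<noteq> 0"
      using \<beta> by simp
    with c(1) have "centroid_unit (\<beta> - \<alpha>) c"
      unfolding centroid_unit_def by blast
    then have "\<beta> - \<alpha> \<in> P"
      unfolding centroid_degrees_def by blast
    then have "rep \<beta> = rep \<alpha>" by (simp add: rep_eq_iff)
    with supp \<alpha> \<beta> show ?thesis by simp
  qed
  have "x = component \<alpha> x"
  proof (rule component_eqI)
    show "component \<epsilon> x = component \<epsilon> (component \<alpha> x)" for \<epsilon>
      using only[of \<epsilon>] by (simp only: component_of_homogeneous[OF component_in_D]) auto
  qed
  then have xD: "x \<in> D \<alpha>" using component_in_D[of \<alpha> x] by simp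
  have "y \<in> I" for y
  proof (induction y rule: homogeneous_induct)
    case (1 \<beta> y)
    then show ?case
      using mult_op_transitive[OF xD x(2)] mult_op_ideal[OF _ I xI] by metis
  next
    case (2 v w)
    then show ?case using I by (simp add: lie_ideal_def subspace_add)
  qed
  then have "A \<subseteq> J"
    by (auto simp: I_def A_def) (metis)
  with JA show ?thesis by blast
qed

lemma A_simple: "simple_lie_algebra scale A br'"
proof -
  interpret A: lie_algebra scale A br' by (rule A_lie_algebra)
  show ?thesis
  proof
    obtain \<alpha> \<beta> x y where xy: "x \<in> D \<alpha>" "y \<in> D \<beta>" "br x y \<noteq> 0"
      using ex_homogeneous_br_nonzero .
    then have "br' (proj x) (proj y) \<noteq> 0"
      using proj_hom_eq_0[OF D_br[OF xy(1,2)]] by (simp add: br'_def proj_br_proj proj_br_proj_left)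
    then show "\<not> A.commutative"
      unfolding A.commutative_def using proj_A by blast
    fix J assume J: "A.lie_ideal J"
    then have "0 \<in> J" by (auto simp: A.lie_ideal_def subspace_0)
    with A_simple_ideal[OF J] show "J = {0} \<or> J = A" by blast
  qed
qed

section \<open>The isomorphism with the loop algebra\<close>

text \<open>
  Degrees in the same coset are merged by \<open>proj\<close>; recording the degree by \<open>t\<^sup>\<alpha>\<close> makes
  \<open>v \<mapsto> \<Sum> proj v\<^sub>\<alpha> \<otimes> t\<^sup>\<alpha>\<close> injective.
\<close>

definition to_loop :: "'v \<Rightarrow> ('q \<Rightarrow>\<^sub>0 'v)" where
  "to_loop v = Abs_poly_mapping (\<lambda>\<alpha>. proj (component \<alpha> v))"

lemma lookup_to_loop: "Poly_Mapping.lookup (to_loop v) \<alpha> = proj (component \<alpha> v)"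
proof -
  have "finite {\<alpha>. proj (component \<alpha> v) \<noteq> 0}"
    by (rule finite_subset[OF _ finite_support[of v]]) auto
  then show ?thesis by (simp add: to_loop_def)
qed

lemma to_loop_add: "to_loop (v + w) = to_loop v + to_loop w"
  by (rule poly_mapping_eqI) (simp add: lookup_to_loop lookup_add component_add proj_add)

lemma to_loop_hom: "v \<in> D \<alpha> \<Longrightarrow> to_loop v = Poly_Mapping.single \<alpha> (proj v)"
  by (rule poly_mapping_eqI)
    (auto simp: lookup_to_loop lookup_single when_def component_of_homogeneous)

lemma to_loop_br: "to_loop (br x y) = tensor_br br' (to_loop x) (to_loop y)"
proof -
  interpret A: lie_algebra scale A br' by (rule A_lie_algebra)
  have T: "to_loop v \<in> tensor_carrier A" for v
    by (simp add: tensor_carrier_def lookup_to_loop)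
  have hom: "to_loop (br x y) = tensor_br br' (to_loop x) (to_loop y)" if "x \<in> D \<alpha>" for x \<alpha>
  proof (induction y rule: homogeneous_induct)
    case (1 \<beta> y)
    then show ?case
      unfolding to_loop_hom[OF that] to_loop_hom[OF 1] to_loop_hom[OF D_br[OF that 1]]
      by (subst A.tensor_br_single) (simp_all add: br'_def proj_br_proj proj_br_proj_left)
  next
    case (2 v w)
    then show ?case
      by (simp add: br_simps to_loop_add A.tensor_br_add_right T)
  qed
  show ?thesis
  proof (induction x rule: homogeneous_induct)
    case (1 \<alpha> x)
    then show ?case by (rule hom)
  next
    case (2 v w)
    then show ?case
      by (simp add: br_simps to_loop_add A.tensor_br_add_left T)
  qed
qed

lemma to_loop_bij: "bij_betw to_loop UNIV (loop_carrier P E)"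
  unfolding bij_betw_def
proof (intro conjI equalityI subsetI)
  show "inj to_loop"
  proof (rule injI)
    fix v w assume eq: "to_loop v = to_loop w"
    show "v = w"
    proof (rule component_eqI)
      fix \<alpha>
      have "proj (component \<alpha> v - component \<alpha> w) = 0"
        using arg_cong[OF eq, of "\<lambda>f. Poly_Mapping.lookup f \<alpha>"]
          by (simp add: lookup_to_loop proj_diff)
      then show "component \<alpha> v = component \<alpha> w"
        using proj_hom_eq_0[OF D_diff[OF component_in_D component_in_D], of \<alpha> v w] by simp
    qed
  qed
  show "f \<in> loop_carrier P E" if "f \<in> range to_loop" for f
    using that by (auto simp: loop_carrier_def lookup_to_loop E_coset proj_D)
  fix f :: "'q \<Rightarrow>\<^sub>0 'v" assume "f \<in> loop_carrier P E"
  then have "\<forall>\<alpha>. \<exists>v. v \<in> D \<alpha> \<and> proj v = Poly_Mapping.lookup f \<alpha>"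
    using proj_image_D by (simp add: loop_carrier_def E_coset) (metis imageE)
  then obtain g where g: "\<And>\<alpha>. g \<alpha> \<in> D \<alpha>" "\<And>\<alpha>. proj (g \<alpha>) = Poly_Mapping.lookup f \<alpha>"
    by metis
  have "to_loop (\<Sum>\<alpha>\<in>Poly_Mapping.keys f. g \<alpha>) = f"
    by (rule poly_mapping_eqI) (simp add: lookup_to_loop component_unique g in_keys_iff)
  then show "f \<in> range to_loop" by (metis rangeI)
qed

lemma to_loop_iso:
  "graded_lie_iso scale UNIV br D
    (pm_scale scale) (loop_carrier P E) (tensor_br br') (loop_component P E) to_loop"
  unfolding graded_lie_iso_def
proof (intro conjI ballI allI)
  show "to_loop (c *s x) = pm_scale scale c (to_loop x)" for c x
    by (rule poly_mapping_eqI) (simp add: lookup_to_loop component_scale proj_scale)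
  show "to_loop ` D \<alpha> = loop_component P E \<alpha>" for \<alpha>
  proof -
    have "to_loop ` D \<alpha> = (\<lambda>v. Poly_Mapping.single \<alpha> (proj v)) ` D \<alpha>"
      by (rule image_cong) (simp_all add: to_loop_hom)
    then show ?thesis
      by (simp add: loop_component_def E_coset image_image flip: proj_image_D)
  qed
qed (simp_all add: to_loop_bij to_loop_add to_loop_br)

end

theorem theorem15:
  fixes scale :: "'k::alg_closed_field \<Rightarrow> 'v::ab_group_add \<Rightarrow> 'v"
    and br :: "'v \<Rightarrow> 'v \<Rightarrow> 'v"
    and D :: "'q::ab_group_add \<Rightarrow> 'v set"
    and B :: "'v set"
  assumes "graded_simple_lie_algebra scale UNIV br UNIV D"
    and "minimal_grading D"
    and "\<not> module.dependent scale B" and "module.span scale B = UNIV"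
    and "B \<prec> (UNIV :: 'k set)"
  shows "\<exists>(P :: 'q set) (A :: 'v set) br' (E :: 'q set \<Rightarrow> 'v set).
    is_subgroup P \<and>
    simple_lie_algebra scale A br' \<and>
    graded_lie_algebra scale A br' (quotient_group P) E \<and>
    (\<exists>\<phi>. graded_lie_iso scale UNIV br D
      (pm_scale scale) (loop_carrier P E) (tensor_br br') (loop_component P E) \<phi>)"
proof -
  interpret small_graded_simple scale br D B
    using assms
      by (simp add: small_graded_simple_def total_graded_simple_def small_graded_simple_axioms_def)
  obtain sec where "\<And>\<gamma>. \<gamma> \<in> centroid_degrees \<Longrightarrow> centroid_unit \<gamma> (sec \<gamma>)"
    "\<And>\<gamma> \<delta>. \<gamma> \<in> centroid_degrees \<Longrightarrow> \<delta> \<in> centroid_degrees \<Longrightarrow> sec (\<gamma> + \<delta>) = sec \<gamma> \<circ> sec \<delta>"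
    using centroid_splits[OF centroidal_0_scalar nth_root_exists] by metis
  then interpret split_centroid scale br D sec
    by unfold_locales
  show ?thesis
    using subgroup_centroid_degrees A_simple A_graded to_loop_iso by blast
qed

end
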